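(* In either the endomorphism setting or the IFS setting, assume that for every $x\in X$ the inverse orbit $O^-(x)$ is dense in $X$. Let $W\in C(X)$, $W\ge0$, with $R_W1=1$, and suppose that $W$ has finitely many zeroes (in the endomorphism setting), respectively that $W\circ\pi$ has finitely many zeroes (in the IFS setting). Let $\nu$ be a probability measure on $X$ with $\nu\circ R_W=\nu$. Then either $\nu$ has full support, or $\nu$ is atomic and supported on $W$-cycles.
   Context: Endomorphism setting: $X$ is a compact metric space, $r:X\to X$ is continuous, onto and finite-to-one; $R_Wf(x)=\sum_{y\in r^{-1}(x)}W(y)f(y)$; $r^{-n}(x)=\{y\mid r^n(y)=x\}$. A cycle is a set $\{x,r(x),\dots,r^{p-1}(x)\}$ with $r^p(x)=x$, $p\geq 1$. IFS setting: $X$ is a compact metric space, $\tau_1,\dots,\tau_N:X\to X$ are contractions with $X=\bigcup_i\tau_i(X)$; $R_Wf(x)=\sum_{i=1}^NW(\tau_ix)f(\tau_ix)$; $r^{-n}(x)=\{\tau_{\omega_1}\cdots\tau_{\omega_n}x\mid\omega_j\in\{1,\dots,N\}\}$. $\Omega=\{1,\dots,N\}^{\mathbb N}$ with left shift $r_\Omega$, and $\pi:\Omega\to X$, $\pi(\omega)=\lim_n\tau_{\omega_1}\cdots\tau_{\omega_n}x_0$ ($x_0\in X$ arbitrary). A cycle is a set $\pi(\{\omega,r_\Omega\omega,\dots,r_\Omega^{p-1}\omega\})$ with $r_\Omega^p\omega=\omega$, $p\ge1$. In both settings $O^-(x)=\bigcup_{n\ge1}r^{-n}(x)$; a $W$-cycle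 is a cycle $C$ with $W(y)=1$ for all $y\in C$; measures are Borel, and $\nu\circ R_W=\nu$ means $\int R_Wf\,d\nu=\int f\,d\nu$ for all $f\in C(X)$. *)

theory Defs
  imports "HOL-Probability.Probability"
begin

text \<open>
  Spaces are compact subsets \<open>X\<close> of a metric space type. All maps, weights and test functions
  are total functions whose values outside \<open>X\<close> are irrelevant.
\<close>

definition borel_probability_on :: "'a::metric_space set \<Rightarrow> 'a measure \<Rightarrow> bool" where
  "borel_probability_on X \<nu> \<longleftrightarrow>
     prob_space \<nu> \<and> space \<nu> = X \<and> sets \<nu> = sets (restrict_space borel X)"

text \<open>The smallest relatively closed subset of \<open>X\<close> whose complement is \<open>\<nu>\<close>-null.\<close>
definition measure_support :: "'a::metric_space set \<Rightarrow> 'a measure \<Rightarrow> 'a set" where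
  "measure_support X \<nu> = {x \<in> X. \<forall>U. open U \<and> x \<in> U \<longrightarrow> measure \<nu> (U \<inter> X) > 0}"

text \<open>Purely atomic: the measure is concentrated on its point masses.\<close>
definition atomic :: "'a measure \<Rightarrow> bool" where
  "atomic \<nu> \<longleftrightarrow> (AE x in \<nu>. measure \<nu> {x} > 0)"

text \<open>
  The following notions are shared by the two settings: \<open>P n x\<close> stands for $r^{-n}(x)$,
  \<open>R\<close> for the operator $R_W$, and \<open>\<C>\<close> for the collection of all cycles.
\<close>

definition inverse_orbit :: "(nat \<Rightarrow> 'a \<Rightarrow> 'a set) \<Rightarrow> 'a \<Rightarrow> 'a set" where
  "inverse_orbit P x = (\<Union>n\<in>{1..}. P n x)"

definition dense_inverse_orbits ::
    "'a::metric_space set \<Rightarrow> (nat \<Rightarrow> 'a \<Rightarrow> 'a set) \<Rightarrow> bool" where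
  "dense_inverse_orbits X P \<longleftrightarrow> (\<forall>x\<in>X. X \<subseteq> closure (inverse_orbit P x))"

definition invariant_measure ::
    "'a::metric_space set \<Rightarrow> (('a \<Rightarrow> real) \<Rightarrow> 'a \<Rightarrow> real) \<Rightarrow> 'a measure \<Rightarrow> bool" where
  "invariant_measure X R \<nu> \<longleftrightarrow>
     (\<forall>f. continuous_on X f \<longrightarrow> (LINT x|\<nu>. R f x) = (LINT x|\<nu>. f x))"

definition W_cycles :: "('a \<Rightarrow> real) \<Rightarrow> 'a set set \<Rightarrow> 'a set set" where
  "W_cycles W \<C> = {C \<in> \<C>. \<forall>y\<in>C. W y = 1}"

subsection \<open>Endomorphisms\<close>

definition endomorphism_setting :: "'a::metric_space set \<Rightarrow> ('a \<Rightarrow> 'a) \<Rightarrow> bool" where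
  "endomorphism_setting X r \<longleftrightarrow>
     compact X \<and> continuous_on X r \<and> r ` X = X \<and> (\<forall>x\<in>X. finite {y \<in> X. r y = x})"

definition endo_transfer ::
    "'a set \<Rightarrow> ('a \<Rightarrow> 'a) \<Rightarrow> ('a \<Rightarrow> real) \<Rightarrow> ('a \<Rightarrow> real) \<Rightarrow> 'a \<Rightarrow> real" where
  "endo_transfer X r W f x = (\<Sum>y\<in>{y \<in> X. r y = x}. W y * f y)"

definition endo_preimages :: "'a set \<Rightarrow> ('a \<Rightarrow> 'a) \<Rightarrow> nat \<Rightarrow> 'a \<Rightarrow> 'a set" where
  "endo_preimages X r n x = {y \<in> X. (r ^^ n) y = x}"

definition endo_cycles :: "'a set \<Rightarrow> ('a \<Rightarrow> 'a) \<Rightarrow> 'a set set" where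
  "endo_cycles X r =
     {(\<lambda>k. (r ^^ k) x) ` {..<p} | x p. x \<in> X \<and> p \<ge> 1 \<and> (r ^^ p) x = x}"

subsection \<open>Iterated function systems\<close>

definition ifs_setting :: "'a::metric_space set \<Rightarrow> nat \<Rightarrow> (nat \<Rightarrow> 'a \<Rightarrow> 'a) \<Rightarrow> bool" where
  "ifs_setting X N \<tau> \<longleftrightarrow>
     compact X \<and>
     (\<forall>i\<in>{1..N}. \<tau> i ` X \<subseteq> X \<and> (\<exists>c<1. c-lipschitz_on X (\<tau> i))) \<and>
     X = (\<Union>i\<in>{1..N}. \<tau> i ` X)"

definition ifs_transfer ::
    "nat \<Rightarrow> (nat \<Rightarrow> 'a \<Rightarrow> 'a) \<Rightarrow> ('a \<Rightarrow> real) \<Rightarrow> ('a \<Rightarrow> real) \<Rightarrow> 'a \<Rightarrow> real" where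
  "ifs_transfer N \<tau> W f x = (\<Sum>i\<in>{1..N}. W (\<tau> i x) * f (\<tau> i x))"

text \<open>
  \<open>foldr \<tau> [\<omega>\<^sub>1, \<dots>, \<omega>\<^sub>n] x\<close> is $\tau_{\omega_1} \cdots \tau_{\omega_n} x$, with $\tau_{\omega_n}$
  applied first.
\<close>
definition ifs_preimages :: "nat \<Rightarrow> (nat \<Rightarrow> 'a \<Rightarrow> 'a) \<Rightarrow> nat \<Rightarrow> 'a \<Rightarrow> 'a set" where
  "ifs_preimages N \<tau> n x = {foldr \<tau> w x | w. length w = n \<and> set w \<subseteq> {1..N}}"

text \<open>Sequences are indexed from \<open>0\<close>: \<open>\<omega> 0\<close> is the first letter $\omega_1$.\<close>
definition symbol_space :: "nat \<Rightarrow> (nat \<Rightarrow> nat) set" where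
  "symbol_space N = {\<omega>. \<forall>k. \<omega> k \<in> {1..N}}"

definition left_shift :: "(nat \<Rightarrow> nat) \<Rightarrow> nat \<Rightarrow> nat" where
  "left_shift \<omega> = (\<lambda>k. \<omega> (Suc k))"

definition coding_map ::
    "(nat \<Rightarrow> 'a::metric_space \<Rightarrow> 'a) \<Rightarrow> 'a \<Rightarrow> (nat \<Rightarrow> nat) \<Rightarrow> 'a" where
  "coding_map \<tau> x0 \<omega> = lim (\<lambda>n. foldr \<tau> (map \<omega> [0..<n]) x0)"

definition ifs_cycles ::
    "nat \<Rightarrow> (nat \<Rightarrow> 'a::metric_space \<Rightarrow> 'a) \<Rightarrow> 'a \<Rightarrow> 'a set set" where
  "ifs_cycles N \<tau> x0 =
     {coding_map \<tau> x0 ` (\<lambda>k. (left_shift ^^ k) \<omega>) ` {..<p} | \<omega> p.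
        \<omega> \<in> symbol_space N \<and> p \<ge> 1 \<and> (left_shift ^^ p) \<omega> = \<omega>}"

end

theory Submission
  imports Defs
begin

text \<open>
  View \<open>R\<^sub>W\<close> as the transition operator of a Markov chain that moves from a point to its inverse
  images, with probabilities given by \<open>W\<close>; \<open>\<nu>\<close> is a stationary law. If a nonempty open set \<open>U\<close> is
  null, then almost every \<open>x\<close> cannot reach \<open>U\<close> along branches of positive weight. By density of the
  inverse orbit some branch reaches \<open>U\<close>, so a zero of \<open>W\<close> lies on the inverse orbit of \<open>x\<close>. Hence
  almost every \<open>x\<close> lies on the forward orbit of one of finitely many zeros (for an iterated function
  system: every address of \<open>x\<close> lies on the forward shift orbit of one of finitely many sequences).
  So \<open>\<nu>\<close> is carried by a countable set and is atomic. Stationarity makes every atom recurrent: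
  each positive branch out of an atom \<open>x\<close> can be continued by positive branches back to \<open>x\<close>, so \<open>x\<close>
  is periodic. A forward orbit contains only finitely many periodic points, so there are finitely
  many atoms; and two different positive branches out of one atom would give too many
  periodic points. Hence the only positive branch at an atom has weight \<open>1\<close>, and atoms lie on
  \<open>W\<close>-cycles.
\<close>

text \<open>Needed so that the set of points reachable by positive steps is Borel: at each length
  finite branching keeps the set of endpoints countable.\<close>

lemma countable_rtranclp_image_finite:
  assumes "\<And>x. finite {y. R x y}"
  shows "countable {y. R\<^sup>*\<^sup>* x y}"
proof -
  have "countable {y. (R ^^ n) x y}" for n
  proof (induction n)
    case (Suc n)
    have "{y. (R ^^ Suc n) x y} = (\<Union>y\<in>{y. (R ^^ n) x y}. {z. R y z})" by auto
    then show ?case using Suc assms by (metis countable_UN countable_finite)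
  qed (auto intro: countable_finite)
  moreover have "{y. R\<^sup>*\<^sup>* x y} = (\<Union>n. {y. (R ^^ n) x y})"
    by (auto simp: rtranclp_power)
  ultimately show ?thesis by auto
qed

subsection \<open>Invariance on Borel sets\<close>

text \<open>The fibre sum need not be continuous, as \<open>r\<close> need not be open. It is Borel because it is the
  pointwise limit of sums over finite partitions of \<open>X\<close> into pieces of vanishing diameter: the
  pieces are countable unions of compact sets, so their images under \<open>r\<close> are Borel.\<close>
lemma finite_fibre_sum_measurable:
  fixes X :: "'a::metric_space set" and r :: "'a \<Rightarrow> 'a" and g :: "'a \<Rightarrow> real"
  assumes "compact X" "continuous_on X r" "\<And>x. x \<in> X \<Longrightarrow> finite {y \<in> X. r y = x}"
    and g: "continuous_on X g"
  shows "(\<lambda>x. \<Sum>y\<in>{y \<in> X. r y = x}. g y) \<in> borel_measurable (restrict_space borel X)"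
proof -
  define e where "e n = 1 / real (Suc n)" for n
  have e_pos: "e n > 0" for n by (simp add: e_def)
  have e_lim: "e \<longlonglongrightarrow> 0" unfolding e_def by (rule LIMSEQ_Suc[OF lim_1_over_n])
  have "\<exists>xs. set xs \<subseteq> X \<and> X \<subseteq> (\<Union>x\<in>set xs. ball x (e n))" for n
    using seq_compact_imp_totally_bounded[OF assms(1)[unfolded compact_eq_seq_compact_metric]] e_pos[of n] by (metis finite_list)
  then obtain xs where xs: "\<And>n. set (xs n) \<subseteq> X"
      "\<And>n. X \<subseteq> (\<Union>x\<in>set (xs n). ball x (e n))" by metis
  define m where "m n = length (xs n)" for n
  define c where "c n j = xs n ! j" for n j
  \<comment> \<open>Choosing the first ball that contains \<open>y\<close> turns the cover into a
    partition of \<open>X\<close>.\<close>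
  define idx where "idx n y = (LEAST j. j < m n \<and> dist (c n j) y < e n)" for n y
  have idx: "idx n y < m n \<and> dist (c n (idx n y)) y < e n" if y: "y \<in> X" for n y
  proof -
    obtain x where "x \<in> set (xs n)" "dist x y < e n" using xs(2)[of n] y by auto
    then obtain j where "j < m n \<and> dist (c n j) y < e n"
      unfolding m_def c_def by (metis in_set_conv_nth)
    then show ?thesis unfolding idx_def by (rule LeastI)
  qed
  have cX: "c n j \<in> X" if "j < m n" for n j
    using that xs(1)[of n] unfolding c_def m_def by auto
  have borel_piece: "r ` {y \<in> X. idx n y = j} \<in> sets borel" if j: "j < m n" for n j
  proof -
    have eq: "{y \<in> X. idx n y = j} = (X - (\<Union>i<j. ball (c n i) (e n))) \<inter> ball (c n j) (e n)"
    proof (intro set_eqI iffI)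
      fix y assume y: "y \<in> {y \<in> X. idx n y = j}"
      then have "\<not> dist (c n i) y < e n" if "i < j" for i
        using that j not_less_Least[of i "\<lambda>j. j < m n \<and> dist (c n j) y < e n"]
        unfolding idx_def by auto
      then show "y \<in> (X - (\<Union>i<j. ball (c n i) (e n))) \<inter> ball (c n j) (e n)"
        using y idx[of y n] by auto
    next
      fix y assume y: "y \<in> (X - (\<Union>i<j. ball (c n i) (e n))) \<inter> ball (c n j) (e n)"
      then have "idx n y = j"
        unfolding idx_def using j
        by (intro Least_equality) (auto simp: not_less[symmetric])
      then show "y \<in> {y \<in> X. idx n y = j}" using y by auto
    qed
    \<comment> \<open>The open ball is exhausted by closed balls of radius \<open>e n - e k\<close>;
      the negative radii for small \<open>k\<close> give empty sets.\<close>
    define K where "K k = (X - (\<Union>i<j. ball (c n i) (e n))) \<inter> cball (c n j) (e n - e k)" for k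
    have "{y \<in> X. idx n y = j} = (\<Union>k. K k)"
    proof -
      have "\<exists>k. d \<le> e n - e k" if d: "d < e n" for d
      proof -
        have "\<forall>\<^sub>F k in sequentially. e k < e n - d"
          using e_lim d by (intro order_tendstoD) auto
        then obtain k where "e k < e n - d" using eventually_sequentially by auto
        then show ?thesis by (intro exI[of _ k]) auto
      qed
      moreover have "d < e n" if "d \<le> e n - e k" for d k using that e_pos[of k] by linarith
      ultimately show ?thesis unfolding eq K_def by (auto simp: mem_ball mem_cball)
    qed
    then have "r ` {y \<in> X. idx n y = j} = (\<Union>k. r ` K k)" by auto
    moreover have "compact (K k)" for k unfolding K_def
      using assms(1) by (intro compact_Int_closed compact_diff) auto
    then have "compact (r ` K k)" for k
      by (intro compact_continuous_image continuous_on_subset[OF assms(2)]) (auto simp: K_def)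
    then have "r ` K k \<in> sets borel" for k by (simp add: compact_imp_closed borel_closed)
    ultimately show ?thesis by auto
  qed
  \<comment> \<open>Every piece that meets the fibre over \<open>x\<close> contributes once, with
    the value of \<open>g\<close> at its centre.\<close>
  define h where "h n x = (\<Sum>j<m n. indicat_real (r ` {y \<in> X. idx n y = j}) x * g (c n j))" for n x
  have hm: "h n \<in> borel_measurable (restrict_space borel X)" for n
    unfolding h_def using borel_piece
    by (intro measurable_restrict_space1 borel_measurable_sum borel_measurable_times
        borel_measurable_indicator borel_measurable_const) auto
  show ?thesis
  proof (rule borel_measurable_LIMSEQ_metric[OF hm])
    fix x assume "x \<in> space (restrict_space borel X)"
    then have x: "x \<in> X" by (simp add: space_restrict_space)
    define Y where "Y = {y \<in> X. r y = x}"
    have Y: "finite Y" "Y \<subseteq> X" using assms(3)[OF x] by (auto simp: Y_def)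
    \<comment> \<open>Two points of one piece are less than \<open>2 * e n\<close> apart, so
      eventually each piece holds at most one point of the finite fibre, and the sum over pieces
      becomes a sum over the fibre.\<close>
    have ev: "\<forall>\<^sub>F n in sequentially. h n x = (\<Sum>y\<in>Y. g (c n (idx n y)))"
    proof -
      have "\<forall>\<^sub>F n in sequentially. idx n y \<noteq> idx n z" if yz: "y \<in> Y" "z \<in> Y" "y \<noteq> z" for y z
      proof -
        have "\<forall>\<^sub>F n in sequentially. e n < dist y z / 2"
          using e_lim yz(3) by (intro order_tendstoD) auto
        then show ?thesis
        proof eventually_elim
          case (elim n)
          have "dist y z \<le> dist (c n (idx n y)) y + dist (c n (idx n y)) z" by (rule dist_triangle3)
          moreover have "dist (c n (idx n y)) y < e n" "dist (c n (idx n z)) z < e n"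
            using idx yz Y by auto
          ultimately show ?case using elim by force
        qed
      qed
      then have "\<forall>\<^sub>F n in sequentially. y \<noteq> z \<longrightarrow> idx n y \<noteq> idx n z" if "y \<in> Y" "z \<in> Y" for y z
        using that by (cases "y = z") auto
      then have "\<forall>\<^sub>F n in sequentially. \<forall>y\<in>Y. \<forall>z\<in>Y. y \<noteq> z \<longrightarrow> idx n y \<noteq> idx n z"
        using Y(1) by (intro eventually_ball_finite ballI) auto
      then show ?thesis
      proof eventually_elim
        case (elim n)
        have inj: "inj_on (idx n) Y" using elim by (auto simp: inj_on_def)
        have "h n x = (\<Sum>j\<in>idx n ` Y. g (c n j))"
          unfolding h_def
        proof (rule sum.mono_neutral_cong_right)
          show "idx n ` Y \<subseteq> {..<m n}" using idx Y by auto
        qed (auto simp: Y_def indicator_def)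
        then show ?case using sum.reindex[OF inj] by simp
      qed
    qed
    have "(\<lambda>n. \<Sum>y\<in>Y. g (c n (idx n y))) \<longlonglongrightarrow> (\<Sum>y\<in>Y. g y)"
    proof (rule tendsto_sum)
      fix y assume "y \<in> Y"
      then have y: "y \<in> X" using Y by auto
      have "(\<lambda>n. c n (idx n y)) \<longlonglongrightarrow> y"
      proof (subst tendsto_dist_iff, rule tendsto_sandwich[OF _ _ tendsto_const e_lim])
        show "\<forall>\<^sub>F n in sequentially. dist (c n (idx n y)) y \<le> e n"
          using idx[OF y] by (auto intro!: always_eventually less_imp_le)
      qed auto
      then show "(\<lambda>n. g (c n (idx n y))) \<longlonglongrightarrow> g y"
        using cX idx[OF y] y by (intro continuous_on_tendsto_compose[OF g]) auto
    qed
    then show "(\<lambda>n. h n x) \<longlonglongrightarrow> (\<Sum>y\<in>{y \<in> X. r y = x}. g y)"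
      using ev unfolding Y_def by (simp add: tendsto_cong)
  qed
qed

text \<open>Both settings are instances: \<open>I x\<close> is the fibre of \<open>r\<close> over \<open>x\<close> with \<open>t y x = y\<close> for an
  endomorphism, and \<open>{1..N}\<close> with \<open>t i = \<tau> i\<close> for an iterated function system.\<close>
locale weighted_branches =
  fixes X :: "'a::metric_space set" and I :: "'a \<Rightarrow> 'i set" and t :: "'i \<Rightarrow> 'a \<Rightarrow> 'a"
    and W :: "'a \<Rightarrow> real" and \<nu> :: "'a measure"
  assumes compact_X: "compact X"
    and W_nonneg: "x \<in> X \<Longrightarrow> W x \<ge> 0"
    and \<nu>: "borel_probability_on X \<nu>"
    and finite_I: "x \<in> X \<Longrightarrow> finite (I x)"
    and t_in_X: "x \<in> X \<Longrightarrow> i \<in> I x \<Longrightarrow> t i x \<in> X"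
    and sum_W: "x \<in> X \<Longrightarrow> (\<Sum>i\<in>I x. W (t i x)) = 1"
    and transfer_measurable_continuous: "continuous_on X f \<Longrightarrow>
      (\<lambda>x. \<Sum>i\<in>I x. W (t i x) * f (t i x)) \<in> borel_measurable \<nu>"
    and transfer_invariant_continuous: "continuous_on X f \<Longrightarrow>
      (LINT x|\<nu>. (\<Sum>i\<in>I x. W (t i x) * f (t i x))) = (LINT x|\<nu>. f x)"
begin

sublocale prob_space \<nu>
  using \<nu> by (simp add: borel_probability_on_def)

lemma space_\<nu>: "space \<nu> = X"
  using \<nu> by (simp add: borel_probability_on_def)

lemma sets_\<nu>_iff: "A \<in> sets \<nu> \<longleftrightarrow> A \<subseteq> X \<and> A \<in> sets borel"
  using \<nu> compact_imp_closed[OF compact_X]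
  by (auto simp: borel_probability_on_def sets_restrict_space_iff)

lemma singleton_sets: "x \<in> X \<Longrightarrow> {x} \<in> sets \<nu>"
  by (simp add: sets_\<nu>_iff)

lemma countable_sets: "C \<subseteq> X \<Longrightarrow> countable C \<Longrightarrow> C \<in> sets \<nu>"
  by (rule sets.countable) (auto intro: singleton_sets)

text \<open>\<open>hit A x\<close> is the probability that the Markov chain that moves from \<open>x\<close> to \<open>t i x\<close> with
  probability \<open>W (t i x)\<close> enters \<open>A\<close> in one step.\<close>
definition hit :: "'a set \<Rightarrow> 'a \<Rightarrow> real" where
  "hit A x = (\<Sum>i\<in>I x. W (t i x) * indicat_real A (t i x))"

lemma hit_bounds: assumes "x \<in> X" shows "0 \<le> hit A x" "hit A x \<le> 1"
proof -
  show "0 \<le> hit A x" unfolding hit_def using assms W_nonneg t_in_X by (intro sum_nonneg) auto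
  have "hit A x \<le> (\<Sum>i\<in>I x. W (t i x))" unfolding hit_def
    using assms W_nonneg t_in_X by (intro sum_mono) (auto simp: indicator_def)
  then show "hit A x \<le> 1" using sum_W[OF assms] by simp
qed

lemma hit_ge:
  assumes "x \<in> X" "i \<in> I x" "t i x \<in> A" shows "W (t i x) \<le> hit A x"
  unfolding hit_def using member_le_sum[of i "I x" "\<lambda>i. W (t i x) * indicat_real A (t i x)"]
    assms W_nonneg t_in_X finite_I by auto

lemma hit_closed:
  assumes "x \<in> X" "\<And>i. i \<in> I x \<Longrightarrow> W (t i x) > 0 \<Longrightarrow> t i x \<in> A"
  shows "hit A x = 1"
proof -
  have "hit A x = (\<Sum>i\<in>I x. W (t i x))"
    unfolding hit_def
  proof (rule sum.cong)
    fix i assume i: "i \<in> I x"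
    then show "W (t i x) * indicat_real A (t i x) = W (t i x)"
      using assms(2)[OF i] W_nonneg[OF t_in_X[OF assms(1) i]]
      by (cases "W (t i x) = 0") (auto simp: indicator_def)
  qed simp
  then show ?thesis using sum_W[OF assms(1)] by simp
qed

text \<open>The continuous functions \<open>max 0 (1 - real n * infdist x A)\<close> decrease to the
  indicator of a nonempty closed set \<open>A\<close>; dominated convergence on both sides
  transports the invariance to the indicator.\<close>

lemma hit_measurable_integral_closed:
  assumes "closed B"
  shows "hit (B \<inter> X) \<in> borel_measurable \<nu> \<and> (LINT x|\<nu>. hit (B \<inter> X) x) = measure \<nu> (B \<inter> X)"
proof (cases "B \<inter> X = {}")
  \<comment> \<open>The distance to the empty set is \<open>0\<close> by convention, so the
    approximating functions of the other case would all be \<open>1\<close> here.\<close>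
  case True
  then show ?thesis by (simp add: hit_def[abs_def])
next
  case False
  define A where "A = B \<inter> X"
  have A: "closed A" "A \<noteq> {}" "A \<subseteq> X"
    using False assms compact_imp_closed[OF compact_X] by (auto simp: A_def)
  then have As: "A \<in> sets \<nu>" by (auto simp: sets_\<nu>_iff)
  define f where "f n x = max 0 (1 - real n * infdist x A)" for n x
  define R where "R n x = (\<Sum>i\<in>I x. W (t i x) * f n (t i x))" for n x
  have f_cont: "continuous_on X (f n)" for n
    unfolding f_def by (intro continuous_intros)
  have f_bounds: "0 \<le> f n x" "f n x \<le> 1" for n x
    unfolding f_def using infdist_nonneg[of x A] by auto
  have f_lim: "(\<lambda>n. f n x) \<longlonglongrightarrow> indicator A x" for x
  proof (cases "x \<in> A")
    case True
    then show ?thesis by (simp add: f_def)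
  next
    case False
    then have "infdist x A > 0" using A in_closed_iff_infdist_zero infdist_nonneg[of x A]
      by (metis less_eq_real_def)
    then obtain N where N: "real N * infdist x A > 1" using reals_Archimedean3 by blast
    have "f n x = 0" if "n \<ge> N" for n
    proof -
      have "real N * infdist x A \<le> real n * infdist x A"
        using that infdist_nonneg by (intro mult_right_mono) auto
      then show ?thesis using N by (simp add: f_def)
    qed
    then have "\<forall>\<^sub>F n in sequentially. f n x = 0" using eventually_sequentially by blast
    then show ?thesis using False by (simp add: tendsto_eventually)
  qed
  have R_meas: "R n \<in> borel_measurable \<nu>" for n
    using transfer_measurable_continuous[OF f_cont[of n]] by (simp add: R_def[abs_def])
  have R_lim: "(\<lambda>n. R n x) \<longlonglongrightarrow> hit A x" for x
    unfolding R_def hit_def by (intro tendsto_intros f_lim)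
  have meas: "hit A \<in> borel_measurable \<nu>"
    by (rule borel_measurable_LIMSEQ_metric[OF R_meas R_lim])
  have R_bound: "norm (R n x) \<le> 1" if "x \<in> X" for n x
  proof -
    have "0 \<le> R n x" unfolding R_def using that W_nonneg t_in_X f_bounds by (intro sum_nonneg) auto
    moreover have "R n x \<le> (\<Sum>i\<in>I x. W (t i x))"
      unfolding R_def using that W_nonneg t_in_X f_bounds by (intro sum_mono mult_left_le) auto
    ultimately show ?thesis using sum_W[OF that] by simp
  qed
  have R_AE: "AE x in \<nu>. norm (R n x) \<le> 1" for n
    using R_bound by (intro AE_I2) (simp add: space_\<nu>)
  have "(\<lambda>n. LINT x|\<nu>. R n x) \<longlonglongrightarrow> (LINT x|\<nu>. hit A x)"
    by (rule integral_dominated_convergence[where w="\<lambda>_. 1"])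
      (use R_AE in \<open>simp_all add: R_meas meas R_lim\<close>)
  moreover have "(\<lambda>n. LINT x|\<nu>. f n x) \<longlonglongrightarrow> (LINT x|\<nu>. indicator A x)"
  proof (rule integral_dominated_convergence[where w="\<lambda>_. 1"])
    have "f n \<in> borel_measurable borel" for n unfolding f_def
      by (intro borel_measurable_continuous_onI continuous_intros)
    then have "f n \<in> borel_measurable (restrict_space borel X)" for n
      by (rule measurable_restrict_space1)
    then show "f n \<in> borel_measurable \<nu>" for n
      using \<nu> measurable_cong_sets[of \<nu> "restrict_space borel X"] by (auto simp: borel_probability_on_def)
  qed (use As f_bounds f_lim in \<open>auto intro!: AE_I2\<close>)
  moreover have "(LINT x|\<nu>. R n x) = (LINT x|\<nu>. f n x)" for n
    using transfer_invariant_continuous[OF f_cont] by (simp add: R_def)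
  ultimately have "(LINT x|\<nu>. hit A x) = (LINT x|\<nu>. indicator A x)"
    using LIMSEQ_unique by auto
  then show ?thesis using meas As sets.sets_into_space[OF As] by (simp add: A_def Int_absorb2)
qed

lemma hit_integrable:
  "hit A \<in> borel_measurable \<nu> \<Longrightarrow> integrable \<nu> (hit A)"
  using hit_bounds space_\<nu> by (intro integrable_const_bound[where B=1]) auto

text \<open>Dynkin class argument: the closed sets are stable under intersection and generate the
  Borel sets. Complements use that the weights sum to \<open>1\<close>, disjoint unions use
  countable additivity. Measurability is carried through the induction together with the integral,
  since both steps integrate the earlier \<open>hit\<close> functions.\<close>

lemma hit_measurable_integral_borel:
  assumes "B \<in> sets borel"
  shows "hit (B \<inter> X) \<in> borel_measurable \<nu> \<and> (LINT x|\<nu>. hit (B \<inter> X) x) = measure \<nu> (B \<inter> X)"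
proof -
  have Xb: "X \<in> sets borel" using compact_imp_closed[OF compact_X] by simp
  have sigma: "A \<in> sigma_sets UNIV (Collect closed) \<longleftrightarrow> A \<in> sets borel" for A :: "'a set"
    by (simp add: borel_eq_closed)
  have "Int_stable (Collect closed :: 'a set set)" by (auto simp: Int_stable_def)
  moreover have "Collect closed \<subseteq> Pow (UNIV :: 'a set)" by simp
  moreover have "B \<in> sigma_sets UNIV (Collect closed)" using assms by (simp add: sigma)
  ultimately show ?thesis
  proof (induct rule: sigma_sets_induct_disjoint)
    case (basic A)
    then show ?case using hit_measurable_integral_closed by simp
  next
    case empty
    then show ?case by (simp add: hit_def[abs_def])
  next
    case (compl A)
    have As: "A \<inter> X \<in> sets \<nu>" using compl(1) Xb by (simp add: sets_\<nu>_iff sigma)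
    have eq: "hit ((UNIV - A) \<inter> X) x = 1 - hit (A \<inter> X) x" if "x \<in> X" for x
    proof -
      have "hit ((UNIV - A) \<inter> X) x + hit (A \<inter> X) x = (\<Sum>i\<in>I x. W (t i x))"
        unfolding hit_def sum.distrib[symmetric]
        using t_in_X[OF that] by (intro sum.cong) (auto simp: indicator_def)
      then show ?thesis using sum_W[OF that] by simp
    qed
    have "(UNIV - A) \<inter> X = space \<nu> - A \<inter> X" by (auto simp: space_\<nu>)
    then have "measure \<nu> ((UNIV - A) \<inter> X) = 1 - measure \<nu> (A \<inter> X)"
      using prob_compl[OF As] by simp
    moreover have "(LINT x|\<nu>. hit ((UNIV - A) \<inter> X) x) = (LINT x|\<nu>. 1 - hit (A \<inter> X) x)"
      by (intro Bochner_Integration.integral_cong) (auto simp: space_\<nu> eq)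
    moreover have "\<dots> = 1 - (LINT x|\<nu>. hit (A \<inter> X) x)"
      using hit_integrable[of "A \<inter> X"] compl(2) by (simp add: prob_space)
    moreover have "hit ((UNIV - A) \<inter> X) \<in> borel_measurable \<nu> \<longleftrightarrow>
        (\<lambda>x. 1 - hit (A \<inter> X) x) \<in> borel_measurable \<nu>"
      by (intro measurable_cong) (auto simp: space_\<nu> eq)
    ultimately show ?case using compl(2) by auto
  next
    case (union A)
    have Ab: "A n \<inter> X \<in> sets \<nu>" for n
      using union(2) Xb sigma[of "A n"] by (auto simp: sets_\<nu>_iff)
    have disj: "disjoint_family (\<lambda>n. A n \<inter> X)" using union(1)
      by (auto simp: disjoint_family_on_def)
    have UN: "(\<Union>n. A n) \<inter> X = (\<Union>n. A n \<inter> X)" by auto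
    have sums: "(\<lambda>n. hit (A n \<inter> X) x) sums hit ((\<Union>n. A n) \<inter> X) x" for x
      unfolding hit_def UN
      by (intro sums_sum sums_mult indicator_sums) (use disj in \<open>auto simp: disjoint_family_on_def\<close>)
    have measA: "hit (A n \<inter> X) \<in> borel_measurable \<nu>" for n using union(3)[of n] by simp
    have meas: "hit ((\<Union>n. A n) \<inter> X) \<in> borel_measurable \<nu>"
    proof (rule borel_measurable_LIMSEQ_metric)
      show "(\<lambda>x. \<Sum>n<m. hit (A n \<inter> X) x) \<in> borel_measurable \<nu>" for m
        by (intro borel_measurable_sum measA)
      show "(\<lambda>m. \<Sum>n<m. hit (A n \<inter> X) x) \<longlonglongrightarrow> hit ((\<Union>n. A n) \<inter> X) x" for x
        using sums[of x] by (simp add: sums_def)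
    qed
    \<comment> \<open>Sum and integral may be interchanged because, by the induction hypothesis, the
      integrals of the nonnegative terms are the measures of disjoint sets and hence
      summable.\<close>
    have "(\<lambda>n. LINT x|\<nu>. hit (A n \<inter> X) x) sums (LINT x|\<nu>. (\<Sum>n. hit (A n \<inter> X) x))"
    proof (rule sums_integral)
      show "integrable \<nu> (hit (A n \<inter> X))" for n by (rule hit_integrable[OF measA])
      show "AE x in \<nu>. summable (\<lambda>n. norm (hit (A n \<inter> X) x))"
      proof (rule AE_I2)
        fix x assume "x \<in> space \<nu>"
        then show "summable (\<lambda>n. norm (hit (A n \<inter> X) x))"
          using sums_summable[OF sums[of x]] hit_bounds(1)[of x] by (simp add: space_\<nu>)
      qed
      have "(\<lambda>n. measure \<nu> (A n \<inter> X)) sums measure \<nu> (\<Union>n. A n \<inter> X)"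
        using Ab disj by (intro finite_measure_UNION) auto
      moreover have "(LINT x|\<nu>. norm (hit (A n \<inter> X) x)) = measure \<nu> (A n \<inter> X)" for n
      proof -
        have "(LINT x|\<nu>. norm (hit (A n \<inter> X) x)) = (LINT x|\<nu>. hit (A n \<inter> X) x)"
          using hit_bounds(1) by (intro Bochner_Integration.integral_cong) (auto simp: space_\<nu>)
        then show ?thesis using union(3)[of n] by simp
      qed
      ultimately show "summable (\<lambda>n. LINT x|\<nu>. norm (hit (A n \<inter> X) x))" by (simp add: sums_iff)
    qed
    moreover have "(\<lambda>n. measure \<nu> (A n \<inter> X)) sums measure \<nu> (\<Union>n. A n \<inter> X)"
      using Ab disj by (intro finite_measure_UNION) auto
    moreover have "(\<Sum>n. hit (A n \<inter> X) x) = hit ((\<Union>n. A n) \<inter> X) x" for x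
      using sums_unique[OF sums[of x]] by simp
    ultimately have "(LINT x|\<nu>. hit ((\<Union>n. A n) \<inter> X) x) = measure \<nu> (\<Union>n. A n \<inter> X)"
      using union(3) sums_unique2 by simp
    then show ?case using meas by (simp only: UN)
  qed
qed

text \<open>This is stationarity of the chain on sets; all later arguments use the invariance of
  \<open>\<nu>\<close> in this form.\<close>

lemma hit_measurable: "A \<in> sets \<nu> \<Longrightarrow> hit A \<in> borel_measurable \<nu>"
  and integral_hit: "A \<in> sets \<nu> \<Longrightarrow> (LINT x|\<nu>. hit A x) = measure \<nu> A"
  using hit_measurable_integral_borel[of A] by (auto simp: sets_\<nu>_iff Int_absorb2)

subsection \<open>Recurrence of atoms\<close>

lemma integrable_indicator_times: "A \<in> sets \<nu> \<Longrightarrow> integrable \<nu> (\<lambda>x. c * indicat_real A x)"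
  by (intro integrable_mult_right integrable_real_indicator) (simp_all add: emeasure_eq_measure)

lemma integral_indicator_times:
  "A \<in> sets \<nu> \<Longrightarrow> (LINT x|\<nu>. c * indicat_real A x) = c * measure \<nu> A"
  using sets.sets_into_space[of A \<nu>] by (simp add: Int_absorb2)

text \<open>Branches of weight zero are included, so that the transitive closure describes the whole
  inverse orbit; the actual transitions of the chain are given by \<open>pos_step\<close>.\<close>

definition step :: "'a \<Rightarrow> 'a \<Rightarrow> bool" where
  "step x y \<longleftrightarrow> x \<in> X \<and> y \<in> (\<lambda>i. t i x) ` I x"

definition pos_step :: "'a \<Rightarrow> 'a \<Rightarrow> bool" where
  "pos_step x y \<longleftrightarrow> step x y \<and> W y > 0"

definition atom :: "'a \<Rightarrow> bool" where
  "atom x \<longleftrightarrow> measure \<nu> {x} > 0"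

lemma atom_in_X: "atom x \<Longrightarrow> x \<in> X"
  unfolding atom_def using measure_notin_sets[of "{x}" \<nu>] by (auto simp: sets_\<nu>_iff)

lemma step_in_X: "step x y \<Longrightarrow> x \<in> X \<and> y \<in> X"
  by (auto simp: step_def t_in_X)

lemma finite_pos_step: "finite {y. pos_step x y}"
proof (cases "x \<in> X")
  case True
  have "{y. pos_step x y} \<subseteq> (\<lambda>i. t i x) ` I x" by (auto simp: pos_step_def step_def)
  then show ?thesis by (rule finite_subset) (rule finite_imageI[OF finite_I[OF True]])
qed (simp add: pos_step_def step_def)

lemma hit_pos: "pos_step x y \<Longrightarrow> y \<in> A \<Longrightarrow> hit A x > 0"
  unfolding pos_step_def step_def using hit_ge by fastforce

lemma exists_pos_step: assumes "x \<in> X" shows "\<exists>y. pos_step x y"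
proof (rule ccontr)
  assume "\<nexists>y. pos_step x y"
  \<comment> \<open>Without positive branches every set is absorbing from \<open>x\<close>, even the
    empty one.\<close>
  then have "hit {} x = 1" using assms
    by (intro hit_closed) (auto simp: pos_step_def step_def)
  then show False by (simp add: hit_def)
qed

text \<open>By stationarity, the points that enter a null set with positive probability in one step
  form a null set again. The union of all iterates of this operation cannot be entered from outside
  by a positive step.\<close>

lemma null_set_closure:
  assumes "U \<in> null_sets \<nu>"
  obtains T where "T \<in> null_sets \<nu>" "U \<subseteq> T" "\<And>x y. pos_step x y \<Longrightarrow> y \<in> T \<Longrightarrow> x \<in> T"
proof -
  define N where "N A = {x \<in> space \<nu>. hit A x \<noteq> 0}" for A
  define T where "T n = (N ^^ n) U" for n
  have N: "N A \<in> null_sets \<nu>" if A: "A \<in> null_sets \<nu>" for A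
  proof -
    have As: "A \<in> sets \<nu>" and "measure \<nu> A = 0" using A by (auto simp: measure_def)
    then have "(LINT x|\<nu>. hit A x) = 0" using integral_hit by simp
    then have "AE x in \<nu>. hit A x = 0"
      using hit_integrable[OF hit_measurable[OF As]] hit_bounds(1)
      by (subst (asm) integral_nonneg_eq_0_iff_AE) (auto simp: space_\<nu>)
    moreover have "N A \<in> sets \<nu>" using hit_measurable[OF As] unfolding N_def by measurable
    ultimately show ?thesis by (subst AE_iff_null_sets) (auto simp: N_def)
  qed
  have T: "T n \<in> null_sets \<nu>" for n
    by (induction n) (auto simp: T_def assms N)
  show thesis
  proof
    show "(\<Union>n. T n) \<in> null_sets \<nu>" using T by (rule null_sets_UN)
    have "T 0 = U" by (simp add: T_def)
    then show "U \<subseteq> (\<Union>n. T n)" by blast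
    fix x y assume xy: "pos_step x y" "y \<in> (\<Union>n. T n)"
    then obtain n where "y \<in> T n" by auto
    then have "hit (T n) x > 0" using xy hit_pos by blast
    then have "x \<in> T (Suc n)"
      using xy(1) by (auto simp: T_def N_def space_\<nu> pos_step_def step_def)
    then show "x \<in> (\<Union>n. T n)" by blast
  qed
qed

text \<open>Take an open null set \<open>U\<close> and enlarge it to a null set \<open>T\<close>
  closed under predecessors. If no zero lies on the inverse orbit of a point outside
  \<open>T\<close>, all steps from there are positive and never enter \<open>T\<close>, whereas
  density leads some of them into \<open>U\<close>.\<close>

lemma zero_on_inverse_orbit:
  assumes "measure_support X \<nu> \<noteq> X"
    and dense: "\<And>x. x \<in> X \<Longrightarrow> X \<subseteq> closure {y. step\<^sup>+\<^sup>+ x y}"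
  shows "\<exists>T\<in>null_sets \<nu>. \<forall>x\<in>X - T. \<exists>z. step\<^sup>+\<^sup>+ x z \<and> W z = 0"
proof -
  obtain u U where u: "u \<in> X" "u \<in> U" "open U" "\<not> measure \<nu> (U \<inter> X) > 0"
    using assms(1) by (auto simp: measure_support_def)
  have "U \<inter> X \<in> sets \<nu>" using u(3) compact_imp_closed[OF compact_X] by (auto simp: sets_\<nu>_iff)
  moreover have "measure \<nu> (U \<inter> X) = 0"
    using u(4) measure_nonneg[of \<nu> "U \<inter> X"] by linarith
  ultimately have "U \<inter> X \<in> null_sets \<nu>" by (simp add: null_sets_def emeasure_eq_measure)
  then obtain T where T: "T \<in> null_sets \<nu>" "U \<inter> X \<subseteq> T"
      "\<And>x y. pos_step x y \<Longrightarrow> y \<in> T \<Longrightarrow> x \<in> T"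
    using null_set_closure by metis
  have "\<exists>z. step\<^sup>+\<^sup>+ x z \<and> W z = 0" if x: "x \<in> X - T" for x
  proof (rule ccontr)
    assume no: "\<nexists>z. step\<^sup>+\<^sup>+ x z \<and> W z = 0"
    have *: "y \<in> X - T" if "step\<^sup>+\<^sup>+ x y" for y
      using that
    proof (induction)
      case (base y)
      then have "W y > 0" using no W_nonneg[of y] step_in_X[of x y]
        by (metis less_eq_real_def tranclp.r_into_trancl)
      then show ?case using base T(3)[of x y] x step_in_X[of x y] by (auto simp: pos_step_def)
    next
      case (step y z)
      then have "step\<^sup>+\<^sup>+ x z" by (rule_tac tranclp.trancl_into_trancl)
      then have "W z > 0" using no W_nonneg[of z] step_in_X[OF step(2)]
        by (metis less_eq_real_def)
      then show ?case using step T(3)[of y z] step_in_X[OF step(2)] by (auto simp: pos_step_def)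
    qed
    have "u \<in> closure {y. step\<^sup>+\<^sup>+ x y}" using dense[of x] x u(1) by auto
    then obtain y where "y \<in> U" "step\<^sup>+\<^sup>+ x y"
      using u(2,3) by (auto simp: closure_iff_nhds_not_empty)
    then show False using * T(2) by blast
  qed
  then show ?thesis using T(1) by blast
qed

text \<open>By stationarity \<open>y\<close> has at least the mass
  \<open>hit {y} x * measure \<nu> {x}\<close> that flows into it from \<open>x\<close>.\<close>

lemma atom_pos_step:
  assumes "atom x" "pos_step x y" shows "atom y"
proof -
  have y: "{y} \<in> sets \<nu>" using assms(2) step_in_X by (auto simp: pos_step_def singleton_sets)
  have x: "{x} \<in> sets \<nu>" using atom_in_X[OF assms(1)] by (rule singleton_sets)
  have "0 < hit {y} x * measure \<nu> {x}" using assms hit_pos by (auto simp: atom_def)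
  also have "\<dots> = (LINT z|\<nu>. hit {y} x * indicator {x} z)"
    by (rule integral_indicator_times[OF x, symmetric])
  also have "\<dots> \<le> (LINT z|\<nu>. hit {y} z)"
    using hit_bounds(1)
    by (intro integral_mono integrable_indicator_times x hit_integrable hit_measurable y)
      (auto simp: space_\<nu> indicator_def)
  also have "\<dots> = measure \<nu> {y}" by (rule integral_hit[OF y])
  finally show ?thesis by (simp add: atom_def)
qed

text \<open>The set \<open>B\<close> of points reachable from \<open>y\<close> is absorbing, so by invariance almost no mass
  outside of \<open>B\<close> flows into it; hence an atom with a positive branch into \<open>B\<close> lies in \<open>B\<close>.\<close>
lemma atom_recurrent:
  assumes "atom x" "pos_step x y" shows "pos_step\<^sup>*\<^sup>* y x"
proof (rule ccontr)
  define B where "B = {z. pos_step\<^sup>*\<^sup>* y z}"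
  assume "\<not> pos_step\<^sup>*\<^sup>* y x"
  then have xB: "x \<notin> B" by (simp add: B_def)
  have BX: "B \<subseteq> X"
  proof
    fix z assume "z \<in> B"
    then have "pos_step\<^sup>*\<^sup>* y z" by (simp add: B_def)
    then show "z \<in> X" by (cases rule: rtranclp.cases) (use assms(2) step_in_X in \<open>auto simp: pos_step_def\<close>)
  qed
  have B: "B \<in> sets \<nu>" using countable_rtranclp_image_finite[OF finite_pos_step] BX
    by (intro countable_sets) (simp_all add: B_def)
  have x: "{x} \<in> sets \<nu>" using atom_in_X[OF assms(1)] by (rule singleton_sets)
  have one: "hit B z = 1" if z: "z \<in> B" for z
  proof (rule hit_closed)
    show "z \<in> X" using z BX by auto
    fix i assume "i \<in> I z" "W (t i z) > 0"
    then have "pos_step z (t i z)" using z BX by (auto simp: pos_step_def step_def)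
    then show "t i z \<in> B" using z by (auto simp: B_def intro: rtranclp.rtrancl_into_rtrancl)
  qed
  have "measure \<nu> B + hit B x * measure \<nu> {x} = (LINT z|\<nu>. indicator B z + hit B x * indicator {x} z)"
    using integral_indicator_times[OF B, of 1] integral_indicator_times[OF x, of "hit B x"]
      integrable_indicator_times[OF B, of 1] integrable_indicator_times[OF x, of "hit B x"]
    by (subst Bochner_Integration.integral_add) (simp_all only: mult_1)
  also have "\<dots> \<le> (LINT z|\<nu>. hit B z)"
  proof (rule integral_mono)
    show "integrable \<nu> (hit B)" by (rule hit_integrable[OF hit_measurable[OF B]])
  next
    fix z assume "z \<in> space \<nu>"
    then show "indicator B z + hit B x * indicator {x} z \<le> hit B z"
      using one[of z] xB hit_bounds(1)[of z B] by (auto simp: indicator_def space_\<nu>)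
  next
    show "integrable \<nu> (\<lambda>z. indicator B z + hit B x * indicator {x} z)"
      using integrable_indicator_times[OF B, of 1] integrable_indicator_times[OF x, of "hit B x"]
      by (intro Bochner_Integration.integrable_add) (simp_all only: mult_1)
  qed
  also have "\<dots> = measure \<nu> B" by (rule integral_hit[OF B])
  finally have "hit B x * measure \<nu> {x} \<le> 0" by simp
  moreover have "hit B x > 0" using hit_pos[OF assms(2)] by (simp add: B_def)
  ultimately show False using assms(1) unfolding atom_def by (metis mult_pos_pos not_less)
qed

lemma atom_notin_null_set: assumes "atom x" "T \<in> null_sets \<nu>" shows "x \<notin> T"
proof
  assume "x \<in> T"
  then have "measure \<nu> {x} \<le> measure \<nu> T" using assms(2) by (intro finite_measure_mono) auto
  then show False using assms measure_eq_0_null_sets[OF assms(2)] by (simp add: atom_def)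
qed

text \<open>The points outside \<open>T\<close> that are not atoms form a countable union of null
  singletons.\<close>

lemma atomicI:
  assumes "T \<in> null_sets \<nu>" "countable (X - T)"
  shows "atomic \<nu>"
proof -
  define C where "C = {x \<in> X - T. \<not> atom x}"
  have "countable C" using assms(2) by (rule countable_subset[rotated]) (auto simp: C_def)
  moreover have "{x} \<in> null_sets \<nu>" if "x \<in> C" for x
    using that measure_nonneg[of \<nu> "{x}"] singleton_sets[of x]
    by (auto simp: C_def atom_def null_sets_def emeasure_eq_measure not_less)
  ultimately have "(\<Union>x\<in>C. {x}) \<in> null_sets \<nu>" by (rule null_sets_UN')
  then have "T \<union> C \<in> null_sets \<nu>" using assms(1) by auto
  then show ?thesis unfolding atomic_def
    by (rule AE_I') (auto simp: space_\<nu> C_def atom_def)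
qed

text \<open>A finite set of atoms is closed, so its complement is open; it is null because the
  measure is atomic.\<close>

lemma support_subset_atoms:
  assumes "atomic \<nu>" "finite {x. atom x}"
  shows "measure_support X \<nu> \<subseteq> {x. atom x}"
proof
  fix x assume x: "x \<in> measure_support X \<nu>"
  show "x \<in> {x. atom x}"
  proof (rule ccontr)
    assume "x \<notin> {x. atom x}"
    then have pos: "measure \<nu> (- {x. atom x} \<inter> X) > 0"
      using x finite_imp_closed[OF assms(2)] by (auto simp: measure_support_def)
    have "- {x. atom x} \<inter> X = space \<nu> - {x. atom x}" by (auto simp: space_\<nu>)
    moreover have "{x. atom x} \<in> sets \<nu>"
      using assms(2) atom_in_X by (intro countable_sets countable_finite) auto
    moreover have "AE x in \<nu>. x \<in> {x. atom x}" using assms(1) by (simp add: atomic_def atom_def)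
    ultimately show False using pos prob_compl[of "{x. atom x}"] prob_eq_1[of "{x. atom x}"] by auto
  qed
qed

end

subsection \<open>Endomorphisms\<close>

lemma funpow_fixed_mult: "(f ^^ p) y = y \<Longrightarrow> (f ^^ (p * q)) y = y"
  by (induction q) (simp_all add: funpow_add)

text \<open>Once the orbit meets one periodic point it stays on the cycle of that point. Every other
  periodic point of the orbit recurs at arbitrarily late times and so lies on the same
  cycle.\<close>

lemma finite_periodic_points_of_orbit:
  "finite {y. (\<exists>k. y = (f ^^ k) z) \<and> (\<exists>p\<ge>1. (f ^^ p) y = y)}" (is "finite ?S")
proof (cases "?S = {}")
  case False
  then obtain k0 p where p: "p \<ge> 1" "(f ^^ p) ((f ^^ k0) z) = (f ^^ k0) z" by auto
  have "?S \<subseteq> (\<lambda>j. (f ^^ j) ((f ^^ k0) z)) ` {..<p}"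
  proof
    fix y assume "y \<in> ?S"
    then obtain k q where q: "y = (f ^^ k) z" "q \<ge> 1" "(f ^^ q) y = y" by auto
    \<comment> \<open>Running \<open>k0\<close> times through the period of \<open>y\<close> raises
      its index on the orbit to at least \<open>k0\<close>.\<close>
    have "y = (f ^^ (k0 * q)) y" using funpow_fixed_mult[OF q(3), of k0] by (simp only: mult.commute)
    then have "y = (f ^^ (k0 * q + k)) z" using q(1) by (simp add: funpow_add)
    moreover have "k0 * q + k = (k0 * q + k - k0) + k0"
      using q(2) by (cases q) auto
    ultimately have "y = (f ^^ (k0 * q + k - k0)) ((f ^^ k0) z)"
      by (metis comp_apply funpow_add)
    then have "y = (f ^^ ((k0 * q + k - k0) mod p)) ((f ^^ k0) z)"
      using funpow_mod_eq[OF p(2)] by metis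
    then show "y \<in> (\<lambda>j. (f ^^ j) ((f ^^ k0) z)) ` {..<p}" using p(1) by auto
  qed
  then show ?thesis by (rule finite_subset) simp
qed (use finite.emptyI in metis)

lemma endomorphism_dichotomy:
  fixes X :: "'a::metric_space set" and W :: "'a \<Rightarrow> real" and \<nu> :: "'a measure"
  assumes W_cont: "continuous_on X W" and W_nonneg: "\<And>x. x \<in> X \<Longrightarrow> W x \<ge> 0"
    and \<nu>: "borel_probability_on X \<nu>"
    and endo: "endomorphism_setting X r"
    and dense: "dense_inverse_orbits X (endo_preimages X r)"
    and sum1: "\<And>x. x \<in> X \<Longrightarrow> endo_transfer X r W (\<lambda>_. 1) x = 1"
    and zeros: "finite {x \<in> X. W x = 0}"
    and inv: "invariant_measure X (endo_transfer X r W) \<nu>"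
    and supp: "measure_support X \<nu> \<noteq> X"
  shows "atomic \<nu> \<and> measure_support X \<nu> \<subseteq> \<Union> (W_cycles W (endo_cycles X r))"
proof -
  have X: "compact X" "continuous_on X r" "r ` X = X" "\<And>x. x \<in> X \<Longrightarrow> finite {y \<in> X. r y = x}"
    using endo by (auto simp: endomorphism_setting_def)
  interpret weighted_branches X "\<lambda>x. {y \<in> X. r y = x}" "\<lambda>y x. y" W \<nu>
  proof
    fix f :: "'a \<Rightarrow> real" assume f: "continuous_on X f"
    have "(\<lambda>x. \<Sum>y\<in>{y \<in> X. r y = x}. W y * f y) \<in> borel_measurable (restrict_space borel X)"
      by (intro finite_fibre_sum_measurable X continuous_intros W_cont f)
    moreover have "sets \<nu> = sets (restrict_space borel X)"
      using \<nu> by (simp add: borel_probability_on_def)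
    ultimately show "(\<lambda>x. \<Sum>y\<in>{y \<in> X. r y = x}. W y * f y) \<in> borel_measurable \<nu>"
      by (subst measurable_cong_sets[OF _ refl])
    show "(LINT x|\<nu>. (\<Sum>y\<in>{y \<in> X. r y = x}. W y * f y)) = (LINT x|\<nu>. f x)"
      using inv f by (simp add: invariant_measure_def endo_transfer_def)
  qed (use X W_nonneg \<nu> sum1 in \<open>auto simp: endo_transfer_def\<close>)

  \<comment> \<open>Steps of the chain and iterates of \<open>r\<close>\<close>
  have step_iff: "step x y \<longleftrightarrow> y \<in> X \<and> r y = x" for x y
    using X(3) by (auto simp: step_def)
  have steps_iff: "step\<^sup>+\<^sup>+ x y \<longleftrightarrow> y \<in> X \<and> (\<exists>n\<ge>1. (r ^^ n) y = x)" for x y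
  proof
    show "y \<in> X \<and> (\<exists>n\<ge>1. (r ^^ n) y = x)" if "step\<^sup>+\<^sup>+ x y"
      using that
    proof (induction)
      case (base y)
      then show ?case by (auto simp: step_iff intro!: exI[of _ 1])
    next
      case (step y z)
      then obtain n where "n \<ge> 1" "(r ^^ n) y = x" by auto
      then have "(r ^^ Suc n) z = x" using step(2) by (simp add: step_iff funpow_swap1)
      then show ?case using step(2) by (auto simp: step_iff intro!: exI[of _ "Suc n"])
    qed
    have "step\<^sup>+\<^sup>+ x y" if "y \<in> X" "(r ^^ Suc n) y = x" for n
      using that
    proof (induction n arbitrary: y)
      case 0
      then show ?case by (auto simp: step_iff)
    next
      case (Suc n)
      then have "step\<^sup>+\<^sup>+ x (r y)" using X(3) by (intro Suc.IH) (auto simp: funpow_swap1)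
      moreover have "step (r y) y" using Suc by (simp add: step_iff)
      ultimately show ?case by (rule tranclp.trancl_into_trancl)
    qed
    then show "step\<^sup>+\<^sup>+ x y" if "y \<in> X \<and> (\<exists>n\<ge>1. (r ^^ n) y = x)"
      using that by (metis One_nat_def Suc_le_D)
  qed
  have dense_steps: "X \<subseteq> closure {y. step\<^sup>+\<^sup>+ x y}" if "x \<in> X" for x
  proof -
    have "inverse_orbit (endo_preimages X r) x = {y. step\<^sup>+\<^sup>+ x y}"
      by (auto simp: inverse_orbit_def endo_preimages_def steps_iff)
    then show ?thesis using dense that by (metis dense_inverse_orbits_def)
  qed

  \<comment> \<open>Countably many points carry the measure\<close>
  obtain T where T: "T \<in> null_sets \<nu>" "\<And>x. x \<in> X - T \<Longrightarrow> \<exists>z. step\<^sup>+\<^sup>+ x z \<and> W z = 0"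
    using zero_on_inverse_orbit[OF supp dense_steps] by blast
  define Z where "Z = {x \<in> X. W x = 0}"
  \<comment> \<open>A zero on the inverse orbit of \<open>x\<close> has \<open>x\<close> on its
    forward orbit.\<close>
  have orbit: "x \<in> (\<Union>z\<in>Z. range (\<lambda>k. (r ^^ k) z))" if "x \<in> X - T" for x
    using T(2)[OF that] by (auto simp: steps_iff Z_def)
  have "finite Z" using zeros by (simp add: Z_def)
  have "countable (\<Union>z\<in>Z. range (\<lambda>k. (r ^^ k) z))"
    by (intro countable_UN countable_image countable_finite[OF \<open>finite Z\<close>]) simp
  moreover have "X - T \<subseteq> (\<Union>z\<in>Z. range (\<lambda>k. (r ^^ k) z))" using orbit by blast
  ultimately have "countable (X - T)" by (rule countable_subset[rotated])
  then have atomic: "atomic \<nu>" by (rule atomicI[OF T(1)])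
  have atom_notin_T: "x \<notin> T" if "atom x" for x
    by (rule atom_notin_null_set[OF that T(1)])

  \<comment> \<open>Periodicity of atoms and uniqueness of the positive branch\<close>
  have iterate_back: "\<exists>k. (r ^^ k) x = y" if "pos_step\<^sup>*\<^sup>* y x" for x y
    using that
  proof (induction)
    case base
    then show ?case by (intro exI[of _ 0]) simp
  next
    case (step u v)
    then obtain k where "(r ^^ k) u = y" by auto
    then have "(r ^^ Suc k) v = y" using step(2) by (simp add: pos_step_def step_iff funpow_swap1)
    then show ?case by blast
  qed
  \<comment> \<open>Positive steps are undone by \<open>r\<close>, so the recurrence path from
    \<open>y\<close> back to \<open>x\<close> shows that iterating \<open>r\<close> leads from
    \<open>x\<close> to \<open>y\<close>, and after one more application back to
    \<open>x\<close>.\<close>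
  have pos_step_back: "\<exists>k. y = (r ^^ k) x \<and> (r ^^ Suc k) x = x" if xy: "atom x" "pos_step x y" for x y
  proof -
    obtain k where "(r ^^ k) x = y" using iterate_back[OF atom_recurrent[OF xy]] by auto
    then show ?thesis using xy(2) by (auto simp: pos_step_def step_iff)
  qed
  have periodic: "\<exists>p\<ge>1. (r ^^ p) x = x" if x: "atom x" for x
  proof -
    obtain k where "(r ^^ Suc k) x = x"
      using exists_pos_step[OF atom_in_X[OF x]] pos_step_back[OF x] by blast
    then show ?thesis by (intro exI[of _ "Suc k"] conjI) simp_all
  qed
  \<comment> \<open>Here \<open>y\<close> and \<open>z\<close> are iterates of \<open>x\<close> with
    exponents \<open>k\<close> and \<open>l\<close>, and \<open>x\<close> has the periods
    \<open>k + 1\<close> and \<open>l + 1\<close>. Adding multiples of these periods brings both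
    exponents to \<open>k * l + k + l\<close>.\<close>
  have unique: "y = z" if xyz: "atom x" "pos_step x y" "pos_step x z" for x y z
  proof -
    obtain k where k: "y = (r ^^ k) x" "(r ^^ Suc k) x = x"
      using pos_step_back[OF xyz(1,2)] by blast
    obtain l where l: "z = (r ^^ l) x" "(r ^^ Suc l) x = x"
      using pos_step_back[OF xyz(1,3)] by blast
    have "(r ^^ (Suc k * l)) x = x" "(r ^^ (Suc l * k)) x = x"
      using funpow_fixed_mult[OF k(2)] funpow_fixed_mult[OF l(2)] by blast+
    then have "y = (r ^^ (k + Suc k * l)) x" "z = (r ^^ (l + Suc l * k)) x"
      using k l by (simp_all only: funpow_add comp_apply)
    moreover have "k + Suc k * l = l + Suc l * k" by simp
    ultimately show ?thesis by metis
  qed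
  have W1: "W y = 1" if xy: "atom x" "pos_step x y" for x y
  proof -
    have x: "x \<in> X" using xy by (auto intro: atom_in_X)
    have "hit {y} x = 1"
      using unique[OF xy] x by (intro hit_closed) (auto simp: pos_step_def step_iff)
    moreover have "hit {y} x = (\<Sum>z\<in>{y}. W z * indicat_real {y} z)"
      unfolding hit_def using xy X(4)[OF x]
      by (intro sum.mono_neutral_right) (auto simp: pos_step_def step_iff)
    ultimately show ?thesis by simp
  qed
  \<comment> \<open>The point \<open>x\<close> can be entered only from \<open>r x\<close>, so
    stationarity reads \<open>measure \<nu> {x} = W x * measure \<nu> {r x}\<close> and both factors
    are positive.\<close>
  have forward: "atom (r x) \<and> pos_step (r x) x" if x: "atom x" for x
  proof -
    have "measure \<nu> {x} = (LINT z|\<nu>. W x * indicat_real {r x} z)"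
    proof -
      have "hit {x} z = W x * indicat_real {r x} z" if "z \<in> X" for z
      proof (cases "r x = z")
        case True
        have "hit {x} z = (\<Sum>u\<in>{x}. W u * indicat_real {x} u)"
          unfolding hit_def using True X(4)[OF that] atom_in_X[OF x]
          by (intro sum.mono_neutral_right) auto
        then show ?thesis using True by simp
      next
        case False
        then show ?thesis unfolding hit_def by (auto simp: indicator_def intro!: sum.neutral)
      qed
      then have "(LINT z|\<nu>. hit {x} z) = (LINT z|\<nu>. W x * indicat_real {r x} z)"
        by (intro Bochner_Integration.integral_cong) (auto simp: space_\<nu>)
      then show ?thesis using integral_hit[OF singleton_sets[OF atom_in_X[OF x]]] by simp
    qed
    also have "\<dots> = W x * measure \<nu> {r x}"
      using X(3) atom_in_X[OF x] by (intro integral_indicator_times singleton_sets) auto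
    finally have eq: "measure \<nu> {x} = W x * measure \<nu> {r x}" .
    have "W x \<noteq> 0" "measure \<nu> {r x} \<noteq> 0" using x eq by (auto simp: atom_def)
    then show ?thesis using W_nonneg[of x] atom_in_X[OF x]
      by (simp add: atom_def pos_step_def step_iff zero_less_measure_iff less_le)
  qed
  have atom_orbit: "atom ((r ^^ k) x)" if "atom x" for k x
    by (induction k) (use that forward in auto)

  \<comment> \<open>Finiteness of the set of atoms, and \<open>W\<close>-cycles\<close>
  have "{x. atom x} \<subseteq> (\<Union>z\<in>Z. {y. (\<exists>k. y = (r ^^ k) z) \<and> (\<exists>p\<ge>1. (r ^^ p) y = y)})"
  proof
    fix x assume "x \<in> {x. atom x}"
    then have x: "atom x" by simp
    then have "x \<in> (\<Union>z\<in>Z. range (\<lambda>k. (r ^^ k) z))"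
      using orbit atom_notin_T atom_in_X by simp
    then show "x \<in> (\<Union>z\<in>Z. {y. (\<exists>k. y = (r ^^ k) z) \<and> (\<exists>p\<ge>1. (r ^^ p) y = y)})"
      using periodic[OF x] by blast
  qed
  moreover have "finite (\<Union>z\<in>Z. {y. (\<exists>k. y = (r ^^ k) z) \<and> (\<exists>p\<ge>1. (r ^^ p) y = y)})"
    by (rule finite_UN_I[OF \<open>finite Z\<close> finite_periodic_points_of_orbit])
  ultimately have "finite {x. atom x}" by (rule finite_subset)
  then have "measure_support X \<nu> \<subseteq> {x. atom x}" by (rule support_subset_atoms[OF atomic])
  also have "\<dots> \<subseteq> \<Union> (W_cycles W (endo_cycles X r))"
  proof
    fix x assume "x \<in> {x. atom x}"
    then have x: "atom x" by simp
    obtain p where p: "p \<ge> 1" "(r ^^ p) x = x" using periodic[OF x] by auto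
    \<comment> \<open>The point \<open>(r ^^ k) x\<close> is the positive branch at the atom that
      follows it on the forward orbit.\<close>
    have "W ((r ^^ k) x) = 1" for k
      using forward[OF atom_orbit[OF x]] W1 by blast
    then have "(\<lambda>k. (r ^^ k) x) ` {..<p} \<in> W_cycles W (endo_cycles X r)"
      using p atom_in_X[OF x] by (auto simp: W_cycles_def endo_cycles_def)
    moreover have "x \<in> (\<lambda>k. (r ^^ k) x) ` {..<p}" using p(1) by (intro image_eqI[of _ _ 0]) auto
    ultimately show "x \<in> \<Union> (W_cycles W (endo_cycles X r))" by blast
  qed
  finally show ?thesis using atomic by blast
qed

subsection \<open>Iterated function systems\<close>

text \<open>The product of periods is a period; this will give one shift exponent that fixes all
  periodic addresses of atoms.\<close>

lemma common_period:
  assumes "finite S" "\<And>y. y \<in> S \<Longrightarrow> \<exists>p\<ge>1. (f ^^ p) y = y"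
  shows "\<exists>P\<ge>1. \<forall>y\<in>S. (f ^^ P) y = y"
  using assms
proof (induction S)
  case (insert y S)
  then obtain P p where P: "P \<ge> 1" "\<forall>y\<in>S. (f ^^ P) y = y" and p: "p \<ge> 1" "(f ^^ p) y = y"
    by (metis insertCI)
  have "(f ^^ (P * p)) z = z" if "z \<in> insert y S" for z
  proof (cases "z = y")
    case True
    then show ?thesis using funpow_fixed_mult[OF p(2), of P] by (simp only: mult.commute)
  next
    case False
    then have "(f ^^ P) z = z" using that P(2) by auto
    then show ?thesis by (rule funpow_fixed_mult)
  qed
  moreover have "P * p \<ge> 1" using P(1) p(1) by simp
  ultimately show ?case by blast
qed auto

section \<open>Addresses of points and periodic words\<close>

lemma left_shift_funpow: "(left_shift ^^ k) \<omega> = (\<lambda>n. \<omega> (n + k))"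
  by (induction k) (auto simp: left_shift_def)

text \<open>A sequence of inverse branches through which \<open>x\<close> can be pulled back forever inside \<open>X\<close>; it is
  then an address of \<open>x\<close> under the coding map.\<close>
definition codes :: "'a set \<Rightarrow> nat \<Rightarrow> (nat \<Rightarrow> 'a \<Rightarrow> 'a) \<Rightarrow> (nat \<Rightarrow> nat) \<Rightarrow> 'a \<Rightarrow> bool" where
  "codes X N \<tau> \<omega> x \<longleftrightarrow> \<omega> \<in> symbol_space N \<and>
     (\<exists>xs. xs 0 = x \<and> (\<forall>n. xs n \<in> X \<and> xs n = \<tau> (\<omega> n) (xs (Suc n))))"

text \<open>Prepending \<open>w\<close> to \<open>\<omega>\<close> gives the required address. This
  turns a zero of \<open>W\<close> on the inverse orbit of \<open>x\<close> into a zero of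
  \<open>W \<circ> \<pi>\<close> whose shift orbit contains the given address of
  \<open>x\<close>.\<close>

lemma codes_append:
  assumes "codes X N \<tau> \<omega> x" "set w \<subseteq> {1..N}" "\<And>i. i \<in> {1..N} \<Longrightarrow> \<tau> i ` X \<subseteq> X"
  shows "\<exists>\<omega>'. codes X N \<tau> \<omega>' (foldr \<tau> w x) \<and> (left_shift ^^ length w) \<omega>' = \<omega>"
  using assms(2)
proof (induction w)
  case Nil
  then show ?case using assms(1) by auto
next
  case (Cons i w)
  then obtain \<omega>' where \<omega>': "codes X N \<tau> \<omega>' (foldr \<tau> w x)" "(left_shift ^^ length w) \<omega>' = \<omega>" by auto
  then obtain xs where xs: "\<omega>' \<in> symbol_space N" "xs 0 = foldr \<tau> w x"
      "\<And>n. xs n \<in> X" "\<And>n. xs n = \<tau> (\<omega>' n) (xs (Suc n))"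
    unfolding codes_def by metis
  have i: "i \<in> {1..N}" using Cons.prems by auto
  define ys where "ys = case_nat (\<tau> i (xs 0)) xs"
  have "codes X N \<tau> (case_nat i \<omega>') (foldr \<tau> (i # w) x)"
    unfolding codes_def
  proof (intro conjI exI[of _ ys] allI)
    show "case_nat i \<omega>' \<in> symbol_space N"
      using i xs(1) by (auto simp: symbol_space_def split: nat.split)
    show "ys 0 = foldr \<tau> (i # w) x" using xs(2) by (simp add: ys_def)
    show "ys n \<in> X" for n using i assms(3)[of i] xs(3) by (cases n) (auto simp: ys_def)
    show "ys n = \<tau> (case n of 0 \<Rightarrow> i | Suc n \<Rightarrow> \<omega>' n) (ys (Suc n))" for n
    proof (cases n)
      case (Suc m)
      then show ?thesis using xs(4)[of m] by (simp add: ys_def)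
    qed (simp add: ys_def)
  qed
  moreover have "(left_shift ^^ length (i # w)) (case_nat i \<omega>') = \<omega>"
    using \<omega>'(2) unfolding left_shift_funpow by simp
  ultimately show ?case by blast
qed

text \<open>Each point is the image of a point of \<open>X\<close> under some branch; a fixed choice
  of branch and preimage is iterated.\<close>

lemma codes_exists:
  assumes X: "X = (\<Union>i\<in>{1..N}. \<tau> i ` X)" and x: "x \<in> X"
  shows "\<exists>\<omega>. codes X N \<tau> \<omega> x"
proof -
  have "\<forall>y\<in>X. \<exists>i z. i \<in> {1..N} \<and> z \<in> X \<and> y = \<tau> i z" using X by blast
  then obtain i p where ip: "\<And>y. y \<in> X \<Longrightarrow> i y \<in> {1..N} \<and> p y \<in> X \<and> y = \<tau> (i y) (p y)"
    by metis
  define xs where "xs n = (p ^^ n) x" for n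
  have xs: "xs n \<in> X" for n by (induction n) (use x ip in \<open>auto simp: xs_def\<close>)
  have "codes X N \<tau> (\<lambda>n. i (xs n)) x"
    unfolding codes_def
  proof (intro conjI exI[of _ xs] allI)
    show "(\<lambda>n. i (xs n)) \<in> symbol_space N" using ip[OF xs] by (simp add: symbol_space_def)
    show "xs 0 = x" by (simp add: xs_def)
    have "xs (Suc n) = p (xs n)" for n by (simp add: xs_def)
    then show "xs n = \<tau> (i (xs n)) (xs (Suc n))" for n using ip[OF xs[of n]] by simp
  qed (rule xs)
  then show ?thesis by blast
qed

definition periodic_word :: "nat list \<Rightarrow> nat \<Rightarrow> nat" where
  "periodic_word w n = w ! (n mod length w)"

lemma periodic_word_period: "(left_shift ^^ length w) (periodic_word w) = periodic_word w"
  by (simp add: left_shift_funpow periodic_word_def fun_eq_iff)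

text \<open>The points met on the way round the loop \<open>w\<close> serve as the backward
  sequence. All shifts are treated at once because a cycle consists of the points that they
  code.\<close>

lemma codes_periodic_word:
  assumes w: "w \<noteq> []" "set w \<subseteq> {1..N}" and x: "x \<in> X" "foldr \<tau> w x = x"
    and \<tau>: "\<And>i. i \<in> {1..N} \<Longrightarrow> \<tau> i ` X \<subseteq> X"
  shows "codes X N \<tau> ((left_shift ^^ k) (periodic_word w)) (foldr \<tau> (drop (k mod length w) w) x)"
proof -
  define xs where "xs n = foldr \<tau> (drop (n mod length w) w) x" for n
  have fold_in_X: "foldr \<tau> v x \<in> X" if "set v \<subseteq> {1..N}" for v
    using that x(1) \<tau> by (induction v) auto
  have xsX: "xs n \<in> X" for n
    unfolding xs_def using w(2) set_drop_subset[of "n mod length w" w] by (intro fold_in_X) auto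
  have xs_Suc: "xs n = \<tau> (periodic_word w n) (xs (Suc n))" for n
  proof -
    have lt: "n mod length w < length w" using w(1) by simp
    then have "xs n = \<tau> (periodic_word w n) (foldr \<tau> (drop (Suc (n mod length w)) w) x)"
      unfolding xs_def periodic_word_def by (simp add: Cons_nth_drop_Suc[symmetric])
    \<comment> \<open>At the end of the word the empty remainder yields \<open>x\<close>, which is
      also the starting point \<open>foldr \<tau> w x\<close> of the next round.\<close>
    moreover have "foldr \<tau> (drop (Suc (n mod length w)) w) x = xs (Suc n)"
      using lt x(2) by (cases "Suc (n mod length w) = length w") (auto simp: xs_def mod_Suc)
    ultimately show ?thesis by simp
  qed
  have "periodic_word w n \<in> {1..N}" for n
    unfolding periodic_word_def using w by (metis length_greater_0_conv mod_less_divisor nth_mem subsetD)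
  then have symb: "(left_shift ^^ k) (periodic_word w) \<in> symbol_space N"
    by (simp add: left_shift_funpow symbol_space_def)
  show ?thesis
    unfolding codes_def
  proof (intro conjI exI[of _ "\<lambda>n. xs (n + k)"] allI)
    show "xs (0 + k) = foldr \<tau> (drop (k mod length w) w) x" by (simp add: xs_def)
    show "xs (n + k) = \<tau> ((left_shift ^^ k) (periodic_word w) n) (xs (Suc n + k))" for n
      using xs_Suc[of "n + k"] by (simp only: left_shift_funpow add_Suc)
  qed (rule symb xsX)+
qed

lemma ifs_contraction:
  assumes "ifs_setting X N \<tau>"
  obtains c where "0 \<le> c" "c < 1"
    "\<And>w x y. set w \<subseteq> {1..N} \<Longrightarrow> x \<in> X \<Longrightarrow> y \<in> X \<Longrightarrow>
      foldr \<tau> w x \<in> X \<and> dist (foldr \<tau> w x) (foldr \<tau> w y) \<le> c ^ length w * dist x y"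
proof -
  have \<tau>: "\<And>i. i \<in> {1..N} \<Longrightarrow> \<tau> i ` X \<subseteq> X" and "\<forall>i\<in>{1..N}. \<exists>c<1. c-lipschitz_on X (\<tau> i)"
    using assms unfolding ifs_setting_def by blast+
  then obtain c where c: "\<And>i. i \<in> {1..N} \<Longrightarrow> c i < 1 \<and> (c i)-lipschitz_on X (\<tau> i)" by metis
  \<comment> \<open>The inserted \<open>0\<close> keeps the maximum defined for an empty alphabet
    and makes it nonnegative.\<close>
  define d where "d = Max (insert 0 (c ` {1..N}))"
  have d: "0 \<le> d" "d < 1" using c by (auto simp: d_def)
  have lip: "dist (\<tau> i x) (\<tau> i y) \<le> d * dist x y" if "i \<in> {1..N}" "x \<in> X" "y \<in> X" for i x y
  proof -
    have "dist (\<tau> i x) (\<tau> i y) \<le> c i * dist x y" using c that lipschitz_onD by blast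
    also have "c i \<le> d" unfolding d_def using that(1) by (intro Max_ge) auto
    then have "c i * dist x y \<le> d * dist x y" by (intro mult_right_mono) auto
    finally show ?thesis .
  qed
  have inX: "foldr \<tau> w x \<in> X" if "set w \<subseteq> {1..N}" "x \<in> X" for w x
    using that \<tau> by (induction w) auto
  have "dist (foldr \<tau> w x) (foldr \<tau> w y) \<le> d ^ length w * dist x y"
    if "set w \<subseteq> {1..N}" "x \<in> X" "y \<in> X" for w x y
    using that(1)
  proof (induction w)
    case (Cons i w)
    have "dist (foldr \<tau> (i # w) x) (foldr \<tau> (i # w) y) \<le> d * dist (foldr \<tau> w x) (foldr \<tau> w y)"
      using Cons that inX lip by simp
    also have "\<dots> \<le> d * (d ^ length w * dist x y)"
      using Cons d by (intro mult_left_mono) auto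
    finally show ?case by (simp add: mult.assoc)
  qed simp
  then show thesis using that[OF d] inX by blast
qed

text \<open>The first \<open>n\<close> maps send \<open>xs n\<close> exactly to \<open>x\<close>;
  with \<open>x0\<close> in place of \<open>xs n\<close> the result differs by at most
  \<open>c ^ n * D\<close>, where \<open>D\<close> bounds the distances from
  \<open>x0\<close>.\<close>

lemma coding_map_codes:
  assumes ifs: "ifs_setting X N \<tau>" and x0: "x0 \<in> X" and "codes X N \<tau> \<omega> x"
  shows "coding_map \<tau> x0 \<omega> = x"
proof -
  obtain c where c: "0 \<le> c" "c < 1"
    "\<And>w x y. set w \<subseteq> {1..N} \<Longrightarrow> x \<in> X \<Longrightarrow> y \<in> X \<Longrightarrow>
      foldr \<tau> w x \<in> X \<and> dist (foldr \<tau> w x) (foldr \<tau> w y) \<le> c ^ length w * dist x y"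
    using ifs_contraction[OF ifs] by metis
  obtain xs where xs: "\<omega> \<in> symbol_space N" "xs 0 = x" "\<And>n. xs n \<in> X"
      "\<And>n. xs n = \<tau> (\<omega> n) (xs (Suc n))"
    using assms(3) unfolding codes_def by metis
  have x: "x = foldr \<tau> (map \<omega> [0..<n]) (xs n)" for n
  proof (induction n)
    case (Suc n)
    then show ?case using xs(4)[of n] by simp
  qed (simp add: xs(2))
  have "compact X" using ifs unfolding ifs_setting_def by blast
  then have "bounded X" by (rule compact_imp_bounded)
  then obtain D where D: "\<And>y. y \<in> X \<Longrightarrow> dist x0 y \<le> D" unfolding bounded_any_center[of X x0] by blast
  have "(\<lambda>n. foldr \<tau> (map \<omega> [0..<n]) x0) \<longlonglongrightarrow> x"
  proof (subst tendsto_dist_iff, rule tendsto_sandwich[OF _ _ tendsto_const])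
    show "(\<lambda>n. c ^ n * D) \<longlonglongrightarrow> 0"
      using c by (intro tendsto_mult_left_zero LIMSEQ_realpow_zero) auto
    show "\<forall>\<^sub>F n in sequentially. dist (foldr \<tau> (map \<omega> [0..<n]) x0) x \<le> c ^ n * D"
    proof (intro always_eventually allI)
      fix n
      have "set (map \<omega> [0..<n]) \<subseteq> {1..N}" using xs(1) by (auto simp: symbol_space_def)
      then have "dist (foldr \<tau> (map \<omega> [0..<n]) x0) (foldr \<tau> (map \<omega> [0..<n]) (xs n))
          \<le> c ^ n * dist x0 (xs n)"
        using c(3)[OF _ x0 xs(3)] by fastforce
      also have "\<dots> \<le> c ^ n * D" using D[OF xs(3)] c(1) by (intro mult_left_mono) auto
      finally show "dist (foldr \<tau> (map \<omega> [0..<n]) x0) x \<le> c ^ n * D" using x[of n] by simp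
    qed
  qed simp
  then show ?thesis unfolding coding_map_def by (rule limI)
qed

lemma ifs_dichotomy:
  fixes X :: "'a::metric_space set" and W :: "'a \<Rightarrow> real" and \<nu> :: "'a measure"
  assumes W_cont: "continuous_on X W" and W_nonneg: "\<And>x. x \<in> X \<Longrightarrow> W x \<ge> 0"
    and \<nu>: "borel_probability_on X \<nu>" and x0: "x0 \<in> X"
    and ifs: "ifs_setting X N \<tau>"
    and dense: "dense_inverse_orbits X (ifs_preimages N \<tau>)"
    and sum1: "\<And>x. x \<in> X \<Longrightarrow> ifs_transfer N \<tau> W (\<lambda>_. 1) x = 1"
    and zeros: "finite {\<omega> \<in> symbol_space N. W (coding_map \<tau> x0 \<omega>) = 0}"
    and inv: "invariant_measure X (ifs_transfer N \<tau> W) \<nu>"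
    and supp: "measure_support X \<nu> \<noteq> X"
  shows "atomic \<nu> \<and> measure_support X \<nu> \<subseteq> \<Union> (W_cycles W (ifs_cycles N \<tau> x0))"
proof -
  note One_nat_def[simp del]
  have X: "compact X" "X = (\<Union>i\<in>{1..N}. \<tau> i ` X)" and \<tau>: "\<And>i. i \<in> {1..N} \<Longrightarrow> \<tau> i ` X \<subseteq> X"
    and lip: "\<And>i. i \<in> {1..N} \<Longrightarrow> \<exists>c<1. c-lipschitz_on X (\<tau> i)"
    using ifs unfolding ifs_setting_def by blast+
  have \<tau>_in: "\<tau> i x \<in> X" if "i \<in> {1..N}" "x \<in> X" for i x using \<tau> that by blast
  have \<tau>_cont: "continuous_on X (\<tau> i)" if "i \<in> {1..N}" for i
    using lip[OF that] lipschitz_on_continuous_on by blast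
  have foldr_in: "foldr \<tau> w x \<in> X" if "set w \<subseteq> {1..N}" "x \<in> X" for w x
    using that \<tau>_in by (induction w) auto
  interpret weighted_branches X "\<lambda>_. {1..N}" \<tau> W \<nu>
  proof
    fix f :: "'a \<Rightarrow> real" assume f: "continuous_on X f"
    have "continuous_on X (\<lambda>x. \<Sum>i\<in>{1..N}. W (\<tau> i x) * f (\<tau> i x))"
      by (intro continuous_on_sum continuous_on_mult
          continuous_on_compose2[OF W_cont \<tau>_cont] continuous_on_compose2[OF f \<tau>_cont] \<tau>)
    then have "(\<lambda>x. \<Sum>i\<in>{1..N}. W (\<tau> i x) * f (\<tau> i x)) \<in> borel_measurable (restrict_space borel X)"
      by (rule borel_measurable_continuous_on_restrict)
    moreover have "sets \<nu> = sets (restrict_space borel X)"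
      using \<nu> by (simp add: borel_probability_on_def)
    ultimately show "(\<lambda>x. \<Sum>i\<in>{1..N}. W (\<tau> i x) * f (\<tau> i x)) \<in> borel_measurable \<nu>"
      by (subst measurable_cong_sets[OF _ refl])
    show "(LINT x|\<nu>. (\<Sum>i\<in>{1..N}. W (\<tau> i x) * f (\<tau> i x))) = (LINT x|\<nu>. f x)"
      using inv f by (simp add: invariant_measure_def ifs_transfer_def)
  next
    show "(\<Sum>i\<in>{1..N}. W (\<tau> i x)) = 1" if "x \<in> X" for x
      using sum1[OF that] by (simp add: ifs_transfer_def)
  qed (use X(1) W_nonneg \<nu> \<tau>_in in auto)

  \<comment> \<open>Steps of the chain as words\<close>
  have step_iff: "step x y \<longleftrightarrow> x \<in> X \<and> (\<exists>i\<in>{1..N}. y = \<tau> i x)" for x y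
    by (auto simp: step_def)
  have steps_iff: "step\<^sup>+\<^sup>+ x y \<longleftrightarrow> (\<exists>w. w \<noteq> [] \<and> set w \<subseteq> {1..N} \<and> y = foldr \<tau> w x)"
    if x: "x \<in> X" for x y
  proof
    show "\<exists>w. w \<noteq> [] \<and> set w \<subseteq> {1..N} \<and> y = foldr \<tau> w x" if "step\<^sup>+\<^sup>+ x y"
      using that
    proof (induction)
      case (base y)
      then obtain i where "i \<in> {1..N}" "y = \<tau> i x" by (auto simp: step_iff)
      then show ?case by (intro exI[of _ "[i]"]) simp
    next
      case (step y z)
      then obtain w i where "set w \<subseteq> {1..N}" "y = foldr \<tau> w x" "i \<in> {1..N}" "z = \<tau> i y"
        by (auto simp: step_iff)
      then show ?case by (intro exI[of _ "i # w"]) simp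
    qed
    have "step\<^sup>+\<^sup>+ x (foldr \<tau> w x)" if "w \<noteq> []" "set w \<subseteq> {1..N}" for w
      using that
    proof (induction w)
      case (Cons i w)
      then have "step (foldr \<tau> w x) (foldr \<tau> (i # w) x)"
        using foldr_in[OF _ x, of w] by (auto simp: step_iff)
      then show ?case using Cons by (cases "w = []") (auto intro: tranclp.trancl_into_trancl)
    qed simp
    then show "step\<^sup>+\<^sup>+ x y" if "\<exists>w. w \<noteq> [] \<and> set w \<subseteq> {1..N} \<and> y = foldr \<tau> w x"
      using that by blast
  qed
  have dense_steps: "X \<subseteq> closure {y. step\<^sup>+\<^sup>+ x y}" if "x \<in> X" for x
  proof -
    have "inverse_orbit (ifs_preimages N \<tau>) x \<subseteq> {y. step\<^sup>+\<^sup>+ x y}"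
    proof
      fix y assume "y \<in> inverse_orbit (ifs_preimages N \<tau>) x"
      then obtain w where "length w \<ge> 1" "set w \<subseteq> {1..N}" "y = foldr \<tau> w x"
        unfolding inverse_orbit_def ifs_preimages_def by blast
      moreover from this have "w \<noteq> []" by auto
      ultimately show "y \<in> {y. step\<^sup>+\<^sup>+ x y}" using steps_iff[OF that] by blast
    qed
    then show ?thesis using dense that closure_mono unfolding dense_inverse_orbits_def by blast
  qed

  \<comment> \<open>Countably many points carry the measure\<close>
  obtain T where T: "T \<in> null_sets \<nu>" "\<And>x. x \<in> X - T \<Longrightarrow> \<exists>z. step\<^sup>+\<^sup>+ x z \<and> W z = 0"
    using zero_on_inverse_orbit[OF supp dense_steps] by blast
  define \<pi> where "\<pi> = coding_map \<tau> x0"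
  have \<pi>: "\<pi> \<omega> = x" if "codes X N \<tau> \<omega> x" for \<omega> x
    unfolding \<pi>_def by (rule coding_map_codes[OF ifs x0 that])
  define Z where "Z = {\<omega> \<in> symbol_space N. W (\<pi> \<omega>) = 0}"
  have Z: "finite Z" using zeros by (simp add: Z_def \<pi>_def)
  \<comment> \<open>This covers every address of \<open>x\<close>, not just a chosen one, so that it
    applies to the periodic addresses of atoms below.\<close>
  have orbit: "\<exists>\<zeta>\<in>Z. \<exists>k. \<omega> = (left_shift ^^ k) \<zeta>" if x: "x \<in> X - T" and \<omega>: "codes X N \<tau> \<omega> x" for x \<omega>
  proof -
    obtain w where w: "set w \<subseteq> {1..N}" "W (foldr \<tau> w x) = 0"
      using T(2)[OF x] steps_iff[of x] x by auto
    obtain \<zeta> where \<zeta>: "codes X N \<tau> \<zeta> (foldr \<tau> w x)" "(left_shift ^^ length w) \<zeta> = \<omega>"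
      using codes_append[OF \<omega> w(1) \<tau>] by blast
    have "\<zeta> \<in> Z" using \<pi>[OF \<zeta>(1)] \<zeta>(1) w(2) by (simp add: Z_def codes_def)
    then show ?thesis using \<zeta>(2) by blast
  qed
  have "countable (\<pi> ` (\<Union>\<zeta>\<in>Z. range (\<lambda>k. (left_shift ^^ k) \<zeta>)))"
    by (intro countable_image countable_UN countable_finite[OF Z]) simp
  moreover have "X - T \<subseteq> \<pi> ` (\<Union>\<zeta>\<in>Z. range (\<lambda>k. (left_shift ^^ k) \<zeta>))"
  proof
    fix x assume x: "x \<in> X - T"
    then obtain \<omega> where \<omega>: "codes X N \<tau> \<omega> x" using codes_exists[OF X(2)] by blast
    then show "x \<in> \<pi> ` (\<Union>\<zeta>\<in>Z. range (\<lambda>k. (left_shift ^^ k) \<zeta>))"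
      using orbit[OF x \<omega>] \<pi>[OF \<omega>] by blast
  qed
  ultimately have "countable (X - T)" by (rule countable_subset[rotated])
  then have atomic: "atomic \<nu>" by (rule atomicI[OF T(1)])

  \<comment> \<open>Periodic addresses of atoms\<close>
  define Per where
    "Per = (\<Union>\<zeta>\<in>Z. {\<omega>. (\<exists>k. \<omega> = (left_shift ^^ k) \<zeta>) \<and> (\<exists>p\<ge>1. (left_shift ^^ p) \<omega> = \<omega>)})"
  have "finite Per"
    unfolding Per_def by (rule finite_UN_I[OF Z finite_periodic_points_of_orbit])
  define loop where "loop x w \<longleftrightarrow> w \<noteq> [] \<and> set w \<subseteq> {1..N} \<and> foldr \<tau> w x = x" for x w
  have loop_codes: "codes X N \<tau> ((left_shift ^^ k) (periodic_word w)) (foldr \<tau> (drop (k mod length w) w) x)"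
    if "loop x w" "x \<in> X" for x w k
    using that by (intro codes_periodic_word \<tau>) (auto simp: loop_def)
  \<comment> \<open>Repeating a loop gives a periodic address, and every address of an atom lies on
    the shift orbit of a zero.\<close>
  have loop_Per: "periodic_word w \<in> Per" if "atom x" "loop x w" for x w
  proof -
    have "codes X N \<tau> (periodic_word w) x"
      using loop_codes[OF that(2) atom_in_X[OF that(1)], of 0] that(2) by (simp add: loop_def)
    moreover have "x \<in> X - T" using atom_in_X[OF that(1)] atom_notin_null_set[OF that(1) T(1)] by simp
    moreover have "length w \<ge> 1" using that(2) by (cases w) (auto simp: loop_def)
    ultimately show ?thesis
      using orbit periodic_word_period[of w] unfolding Per_def by blast
  qed
  \<comment> \<open>One exponent serves for the periodic words of all loops at all atoms, however
    long the loops are.\<close>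
  obtain P where P: "P \<ge> 1" "\<And>\<omega>. \<omega> \<in> Per \<Longrightarrow> (left_shift ^^ P) \<omega> = \<omega>"
    using common_period[OF \<open>finite Per\<close>, of left_shift] by (auto simp: Per_def)
  \<comment> \<open>The periodic word of \<open>v u\<^sup>P\<close> is invariant under the shift by \<open>P\<close>, and the last letters of \<open>v\<close>
    and of \<open>u\<^sup>P\<close> are a multiple of \<open>P\<close> apart.\<close>
  have loop_last: "last u = last v" if x: "atom x" and uv: "loop x u" "loop x v" for x u v
  proof -
    define u' where "u' = concat (replicate P u)"
    define w where "w = v @ u'"
    have "foldr \<tau> (concat (replicate n u)) x = x" for n
      using uv(1) by (induction n) (auto simp: loop_def)
    moreover have "set u' \<subseteq> {1..N}" using uv(1) by (auto simp: u'_def loop_def)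
    ultimately have "loop x w" using uv(2) by (simp add: loop_def w_def u'_def)
    then have "(left_shift ^^ P) (periodic_word w) = periodic_word w"
      using P(2) loop_Per[OF x] by blast
    then have "(left_shift ^^ (P * length u)) (periodic_word w) = periodic_word w"
      by (rule funpow_fixed_mult)
    then have eq: "periodic_word w (length v - 1 + P * length u) = periodic_word w (length v - 1)"
      by (metis left_shift_funpow)
    have ne: "v \<noteq> []" "u \<noteq> []" using uv by (auto simp: loop_def)
    have len: "length u' = P * length u" by (simp add: u'_def length_concat sum_list_replicate)
    have "P * length u > 0" using P(1) ne by simp
    then have "u' \<noteq> []" using len by auto
    have "periodic_word w (length v - 1) = last v"
    proof -
      have lt: "length v - 1 < length v" using ne by simp
      then have "(length v - 1) mod length w = length v - 1" by (intro mod_less) (simp add: w_def)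
      then have "periodic_word w (length v - 1) = w ! (length v - 1)"
        by (simp only: periodic_word_def)
      also have "\<dots> = last v" using lt ne by (simp add: w_def nth_append last_conv_nth)
      finally show ?thesis .
    qed
    moreover have "periodic_word w (length v - 1 + P * length u) = last w"
    proof -
      have "length v - 1 + P * length u = length w - 1"
        using ne by (cases v) (simp_all add: w_def len)
      then show ?thesis using ne by (simp add: periodic_word_def last_conv_nth w_def)
    qed
    moreover have "last w = last u"
    proof -
      have "u' = concat (replicate (P - 1) u) @ u"
      proof -
        have "replicate P u = replicate (P - 1) u @ [u]"
          using P(1) by (metis Suc_diff_1 less_le_trans replicate_Suc replicate_append_same zero_less_one)
        then show ?thesis unfolding u'_def by simp
      qed
      then show ?thesis using ne by (simp add: w_def)
    qed
    ultimately show ?thesis using eq by simp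
  qed
  \<comment> \<open>The points \<open>foldr \<tau> (drop k w) y\<close> run through the path from
    its end to its first point after \<open>y\<close>. Each is recorded as the target of a positive
    step, which later determines its weight.\<close>
  have path: "\<exists>w. set w \<subseteq> {1..N} \<and> z = foldr \<tau> w y \<and>
      (\<forall>k<length w. \<exists>a. pos_step\<^sup>*\<^sup>* y a \<and> pos_step a (foldr \<tau> (drop k w) y))"
    if "pos_step\<^sup>*\<^sup>* y z" for y z
    using that
  proof (induction)
    case base
    then show ?case by (intro exI[of _ "[]"]) simp
  next
    case (step z z')
    then obtain w where w: "set w \<subseteq> {1..N}" "z = foldr \<tau> w y"
      "\<And>k. k < length w \<Longrightarrow> \<exists>a. pos_step\<^sup>*\<^sup>* y a \<and> pos_step a (foldr \<tau> (drop k w) y)" by blast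
    obtain i where i: "i \<in> {1..N}" "z' = \<tau> i z" using step(2) by (auto simp: pos_step_def step_iff)
    have "\<exists>a. pos_step\<^sup>*\<^sup>* y a \<and> pos_step a (foldr \<tau> (drop k (i # w)) y)" if "k < length (i # w)" for k
    proof (cases k)
      case 0
      then show ?thesis using step(1,2) w(2) i by auto
    next
      case (Suc j)
      then show ?thesis using w(3)[of j] that by simp
    qed
    then show ?case using w i by (intro exI[of _ "i # w"]) auto
  qed
  \<comment> \<open>Recurrence closes the step to \<open>\<tau> i x\<close> up to a loop. As
    \<open>foldr\<close> applies the last letter first, the initial branch \<open>i\<close> is the
    last letter of this loop.\<close>
  have loop_through: "\<exists>w. loop x (w @ [i]) \<and>
      (\<forall>k<length w. \<exists>a. pos_step\<^sup>*\<^sup>* (\<tau> i x) a \<and> pos_step a (foldr \<tau> (drop k w) (\<tau> i x)))"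
    if xi: "atom x" "i \<in> {1..N}" "pos_step x (\<tau> i x)" for x i
  proof -
    obtain w where w: "set w \<subseteq> {1..N}" "x = foldr \<tau> w (\<tau> i x)"
      "\<forall>k<length w. \<exists>a. pos_step\<^sup>*\<^sup>* (\<tau> i x) a \<and> pos_step a (foldr \<tau> (drop k w) (\<tau> i x))"
      using path[OF atom_recurrent[OF xi(1,3)]] by blast
    have "loop x (w @ [i])" using w(1) w(2)[symmetric] xi(2) by (simp add: loop_def)
    then show ?thesis using w(3) by blast
  qed

  \<comment> \<open>Weight one along loops at atoms\<close>
  have W1: "W y = 1" if xy: "atom x" "pos_step x y" for x y
  proof -
    have x: "x \<in> X" by (rule atom_in_X[OF xy(1)])
    obtain i where i: "i \<in> {1..N}" "y = \<tau> i x" using xy(2) by (auto simp: pos_step_def step_iff)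
    \<comment> \<open>Positive branches with distinct letters \<open>i\<close> and \<open>j\<close>
      would give loops with distinct last letters, against \<open>loop_last\<close>. The comparison
      is between letters, so it also covers \<open>\<tau> i x = \<tau> j x\<close>.\<close>
    have "W (\<tau> j x) = 0" if j: "j \<in> {1..N} - {i}" for j
    proof (rule ccontr)
      assume "W (\<tau> j x) \<noteq> 0"
      then have "pos_step x (\<tau> j x)"
        using j x W_nonneg[OF \<tau>_in[of j x]] by (auto simp: pos_step_def step_iff)
      then obtain v where "loop x (v @ [j])" using loop_through[OF xy(1)] j by blast
      moreover obtain w where "loop x (w @ [i])" using loop_through[OF xy(1)] i xy(2) by blast
      ultimately have "last (v @ [j]) = last (w @ [i])" by (rule loop_last[OF xy(1)])
      then show False using j by simp
    qed
    then have "(\<Sum>j\<in>{1..N}. W (\<tau> j x)) = (\<Sum>j\<in>{i}. W (\<tau> j x))"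
      using i(1) by (intro sum.mono_neutral_right) auto
    then show ?thesis using sum_W[OF x] i(2) by simp
  qed
  have atom_steps: "atom z" if "pos_step\<^sup>*\<^sup>* y z" "atom y" for y z
    using that by (induction) (auto intro: atom_pos_step)
  have cycle: "\<exists>w. loop x w \<and> (\<forall>k<length w. W (foldr \<tau> (drop k w) x) = 1)" if x: "atom x" for x
  proof -
    obtain y where y: "pos_step x y" using exists_pos_step[OF atom_in_X[OF x]] by blast
    then obtain i where "i \<in> {1..N}" "y = \<tau> i x" by (auto simp: pos_step_def step_iff)
    then have i: "i \<in> {1..N}" "pos_step x (\<tau> i x)" using y by simp_all
    obtain w where w: "loop x (w @ [i])"
      "\<And>k. k < length w \<Longrightarrow> \<exists>a. pos_step\<^sup>*\<^sup>* (\<tau> i x) a \<and> pos_step a (foldr \<tau> (drop k w) (\<tau> i x))"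
      using loop_through[OF x i] by blast
    \<comment> \<open>Each point of the loop is the target of a positive step from an atom, since
      atoms propagate along positive steps; the index \<open>k = length w\<close> stands for the
      initial step to \<open>\<tau> i x\<close>.\<close>
    have "W (foldr \<tau> (drop k (w @ [i])) x) = 1" if "k < length (w @ [i])" for k
    proof (cases "k < length w")
      case True
      then show ?thesis using w(2)[OF True] W1 atom_steps atom_pos_step[OF x i(2)] by fastforce
    next
      case False
      then have "k = length w" using that by simp
      then show ?thesis using W1[OF x i(2)] by simp
    qed
    then show ?thesis using w(1) by blast
  qed

  \<comment> \<open>Finiteness of the set of atoms, and \<open>W\<close>-cycles\<close>
  have "{x. atom x} \<subseteq> \<pi> ` Per"
  proof
    fix x assume "x \<in> {x. atom x}"
    then have x: "atom x" by simp
    obtain w where w: "loop x w" using cycle[OF x] by blast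
    then have "\<pi> (periodic_word w) = x"
      using \<pi>[OF loop_codes[OF w atom_in_X[OF x], of 0]] by (simp add: loop_def)
    then show "x \<in> \<pi> ` Per" using loop_Per[OF x w] by blast
  qed
  then have "finite {x. atom x}" using \<open>finite Per\<close> by (rule finite_subset[OF _ finite_imageI])
  then have "measure_support X \<nu> \<subseteq> {x. atom x}" by (rule support_subset_atoms[OF atomic])
  also have "\<dots> \<subseteq> \<Union> (W_cycles W (ifs_cycles N \<tau> x0))"
  proof
    fix x assume "x \<in> {x. atom x}"
    then have x: "atom x" by simp
    obtain w where w: "loop x w" "\<And>k. k < length w \<Longrightarrow> W (foldr \<tau> (drop k w) x) = 1"
      using cycle[OF x] by blast
    define C where "C = \<pi> ` (\<lambda>k. (left_shift ^^ k) (periodic_word w)) ` {..<length w}"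
    have len: "length w \<ge> 1" using w(1) by (cases w) (auto simp: loop_def)
    have \<pi>_w: "\<pi> ((left_shift ^^ k) (periodic_word w)) = foldr \<tau> (drop k w) x" if "k < length w" for k
      using \<pi>[OF loop_codes[OF w(1) atom_in_X[OF x], of k]] that by simp
    have "periodic_word w \<in> symbol_space N"
      using loop_codes[OF w(1) atom_in_X[OF x], of 0] by (simp add: codes_def)
    then have "C \<in> ifs_cycles N \<tau> x0"
      unfolding ifs_cycles_def C_def \<pi>_def using len periodic_word_period by blast
    moreover have "\<forall>y\<in>C. W y = 1" using \<pi>_w w(2) by (auto simp: C_def)
    moreover have "x \<in> C"
    proof -
      have "x = \<pi> ((left_shift ^^ 0) (periodic_word w))"
        using \<pi>_w[of 0] len w(1) by (simp add: loop_def)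
      moreover have "0 \<in> {..<length w}" using len by auto
      ultimately show ?thesis unfolding C_def by blast
    qed
    ultimately show "x \<in> \<Union> (W_cycles W (ifs_cycles N \<tau> x0))" by (auto simp: W_cycles_def)
  qed
  finally show ?thesis using atomic by blast
qed

theorem theorem5p4:
  fixes X :: "'a::metric_space set" and W :: "'a \<Rightarrow> real" and \<nu> :: "'a measure"
  assumes "continuous_on X W" and "\<forall>x\<in>X. W x \<ge> 0"
    and "borel_probability_on X \<nu>"
  shows
    "(\<forall>r. endomorphism_setting X r \<longrightarrow>
          dense_inverse_orbits X (endo_preimages X r) \<longrightarrow>
          (\<forall>x\<in>X. endo_transfer X r W (\<lambda>_. 1) x = 1) \<longrightarrow>
          finite {x \<in> X. W x = 0} \<longrightarrow>
          invariant_measure X (endo_transfer X r W) \<nu> \<longrightarrow>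
          measure_support X \<nu> = X \<or>
          (atomic \<nu> \<and> measure_support X \<nu> \<subseteq> \<Union> (W_cycles W (endo_cycles X r))))
     \<and>
     (\<forall>N \<tau>. \<forall>x0\<in>X. ifs_setting X N \<tau> \<longrightarrow>
          dense_inverse_orbits X (ifs_preimages N \<tau>) \<longrightarrow>
          (\<forall>x\<in>X. ifs_transfer N \<tau> W (\<lambda>_. 1) x = 1) \<longrightarrow>
          finite {\<omega> \<in> symbol_space N. W (coding_map \<tau> x0 \<omega>) = 0} \<longrightarrow>
          invariant_measure X (ifs_transfer N \<tau> W) \<nu> \<longrightarrow>
          measure_support X \<nu> = X \<or>
          (atomic \<nu> \<and> measure_support X \<nu> \<subseteq> \<Union> (W_cycles W (ifs_cycles N \<tau> x0))))"
proof (intro conjI allI impI ballI)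
  fix r
  assume *: "endomorphism_setting X r" "dense_inverse_orbits X (endo_preimages X r)"
    "\<forall>x\<in>X. endo_transfer X r W (\<lambda>_. 1) x = 1" "finite {x \<in> X. W x = 0}"
    "invariant_measure X (endo_transfer X r W) \<nu>"
  show "measure_support X \<nu> = X \<or>
    (atomic \<nu> \<and> measure_support X \<nu> \<subseteq> \<Union> (W_cycles W (endo_cycles X r)))"
    using endomorphism_dichotomy[OF assms(1) _ assms(3) *(1,2) _ *(4,5)] assms(2) *(3) by blast
next
  fix N \<tau> x0
  assume *: "x0 \<in> X" "ifs_setting X N \<tau>" "dense_inverse_orbits X (ifs_preimages N \<tau>)"
    "\<forall>x\<in>X. ifs_transfer N \<tau> W (\<lambda>_. 1) x = 1"
    "finite {\<omega> \<in> symbol_space N. W (coding_map \<tau> x0 \<omega>) = 0}"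
    "invariant_measure X (ifs_transfer N \<tau> W) \<nu>"
  show "measure_support X \<nu> = X \<or>
    (atomic \<nu> \<and> measure_support X \<nu> \<subseteq> \<Union> (W_cycles W (ifs_cycles N \<tau> x0)))"
    using ifs_dichotomy[OF assms(1) _ assms(3) *(1-3) _ *(5,6)] assms(2) *(4) by blast
qed

end
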